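(* (Converse construction for $\mathrm{CD}_{2\not\sim}$.) Let $G$ be a finite innately transitive group on $\Omega$ with a non-abelian plinth $M$, let $T_1,\ldots,T_k$ be the simple direct factors of $M$, $\mathcal T=\{T_1,\dots,T_k\}$, and let $\omega\in\Omega$. Assume that $M_\omega=\sigma_1(M_\omega)\times\cdots\times\sigma_k(M_\omega)$. Suppose that $A_1,B_1$ are subgroups of $T_1$ such that (i) $A_1,B_1$ are proper subgroups of $T_1$; (ii) $A_1$ and $B_1$ are not conjugate under $G_\omega$; (iii) $A_1B_1=T_1$ and $A_1\cap B_1=\sigma_1(M_\omega)$; (iv) $N_{G_\omega}(T_1)=N_{G_\omega}(A_1)=N_{G_\omega}(B_1)$. Suppose further that $\Gamma=(V,\mathcal T,\beta,\varepsilon)$ is a generalised di-graph and that $G_\omega$ acts on $V\cup\mathcal T$ inducing a vertex-transitive and arc-transitive group of automorphisms of $\Gamma$, where the action of $G_\omega$ on $\mathcal T$ is by conjugation. For $i=1,\dots,k$ choose $g_i\in G_\omega$ with $T_1^{g_i}=T_i$ and put $A_i=A_1^{g_i}$, $B_i=B_1^{g_i}$. For $v\in V$ put $K_v=\prod_{i=1}^kK_{v,i}$, where $K_{v,i}=A_i$ if $\beta(T_i)=v$, $K_{v,i}=B_i$ if $\varepsilon(T_i)=v$, and $K_{v,i}=T_i$ otherwise. Then the $K_{v,i}$ do not depend on the choice of the $g_i$, and $\mathcal K=\{K_v : v\in V\}$ is a $G_\omega$-invariant Cartesian system of subgroups for $M$ with respect to $\omega$ on which $G_\omega$ acts transitively.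 Moreover $\mathcal E(\mathcal K)\in\mathrm{CD}_{2\not\sim}(G)$, $\Gamma=\Gamma(G,\mathcal E(\mathcal K))$ under the identification $v\leftrightarrow K_v$, and $\mathcal F_i(\mathcal E(\mathcal K),M,\omega)=\{A_i,B_i\}$ for each $i$.
   Context: All groups act on the right. A permutation group $G\le \mathrm{Sym}\,\Omega$ is *innately transitive* if it has a transitive minimal normal subgroup, called a *plinth*. A *Cartesian decomposition* of $\Omega$ is a set $\{\Gamma_1,\dots,\Gamma_\ell\}$ of proper partitions of $\Omega$ with $|\gamma_1\cap\dots\cap\gamma_\ell|=1$ for all $\gamma_1\in\Gamma_1,\dots,\gamma_\ell\in\Gamma_\ell$. It is *$G$-invariant* if $G$ permutes the $\Gamma_i$. $\mathrm{CD}_{\mathrm{tr}}(G)$ is the set of $G$-invariant Cartesian decompositions on which $G$ acts transitively. For a transitive group $M$ on $\Omega$ and $\omega\in\Omega$, a set $\{K_1,\dots,K_\ell\}$ of proper subgroups of $M$ is a *Cartesian system of subgroups for $M$ with respect to $\omega$* if $\bigcap_i K_i=M_\omega$ and $K_i(\bigcap_{j\ne i}K_j)=M$ for all $i$. Let $G$ be innately transitive with plinth $M$. If $\mathcal E=\{\Gamma_1,\dots,\Gamma_\ell\}$ is a $G$-invariant Cartesian decomposition, it is known that each $\Gamma_i$ is $M$-invariant; let $\gamma_i\in\Gamma_i$ be the block containing $\omega$ and $\mathcal K_\omega(\mathcal E)=\{K_1,\dots,K_\ell\}$ with $K_i=M_{\gamma_i}$ (setwise stabiliser). It is known that $\mathcal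 E\mapsto\mathcal K_\omega(\mathcal E)$ is a bijection from $G$-invariant Cartesian decompositions to $G_\omega$-invariant (under conjugation) Cartesian systems for $M$ with respect to $\omega$; the inverse is $\mathcal K\mapsto \mathcal E(\mathcal K)=\{\{(\omega^K)^m: m\in M\}: K\in\mathcal K\}$. $\sigma_i:M\to T_i$ is the projection. Put $\mathcal F_i(\mathcal E,M,\omega)=\{\sigma_i(K_j): 1\le j\le\ell,\ \sigma_i(K_j)\neq T_i\}$. $\mathrm{CD}_{2\not\sim}(G)$ is the set of $\mathcal E\in\mathrm{CD}_{\mathrm{tr}}(G)$ such that, for each $i$, $|\mathcal F_i|=2$ and the two subgroups in $\mathcal F_i$ are not $G_\omega$-conjugate. A *generalised di-graph* is a 4-tuple $(V,E,\beta,\varepsilon)$ with $V$, $E$ disjoint sets (vertices, arcs), $V\neq\emptyset$, and maps $\beta,\varepsilon:E\to V$ with $\beta(e)\ne\varepsilon(e)$ for all $e\in E$. An automorphism is $\alpha\in\mathrm{Sym}\,V\times\mathrm{Sym}\,E$ with $\alpha(\beta(e))=\beta(\alpha(e))$ and $\alpha(\varepsilon(e))=\varepsilon(\alpha(e))$ for all $e\in E$. For $\mathcal E\in\mathrm{CD}_{2\not\sim}(G)$ with $\mathcal F_1(\mathcal E,M,\omega)=\{A_1,B_1\}$, $\Gamma(G,\mathcal E)$ is the generalised di-graph $(\mathcal K_\omega(\mathcal E),\mathcal T,\beta,\varepsilon)$ where $\beta(T_i)$ is the unique $K\in\mathcal K_\omega(\mathcal E)$ with $\sigma_i(K)$ $G_\omega$-conjugate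 to $A_1$ and $\varepsilon(T_i)$ is the unique $K\in\mathcal K_\omega(\mathcal E)$ with $\sigma_i(K)$ $G_\omega$-conjugate to $B_1$. *)

theory Defs
  imports
    "HOL-Algebra.Group_Action"
    "HOL-Algebra.SimpleGroups"
    "HOL-Library.Disjoint_Sets"
    "Graph_Theory.Digraph"
begin

text \<open>
  Groups act on the right in the source. The symmetric group on \<open>\<Omega>\<close> is rendered as
  \<^term>\<open>BijGroup \<Omega>\<close>, whose multiplication is composition of functions, so that the image
  \<open>x\<^sup>g\<close> is \<open>g x\<close> and the source product \<open>xy\<close> is \<open>y \<otimes> x\<close>. Consequently the conjugate
  \<open>A\<^sup>g = g\<^sup>-\<^sup>1 A g\<close> is \<open>g \<otimes> A \<otimes> inv g\<close>, a right action of a permutation group is a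
  homomorphism into \<^term>\<open>BijGroup V\<close>, and notions such as subgroup, normal subgroup and
  the factorisation \<open>AB = M\<close> for subgroups \<open>A, B\<close> of a group \<open>M\<close> (equivalent to \<open>BA = M\<close>)
  do not depend on the order of multiplication.
\<close>

section \<open>Permutation groups\<close>

abbreviation perm_group :: "'a set \<Rightarrow> ('a \<Rightarrow> 'a) set \<Rightarrow> ('a \<Rightarrow> 'a) monoid" where
  "perm_group \<Omega> H \<equiv> BijGroup \<Omega> \<lparr>carrier := H\<rparr>"

definition pt_stab :: "'a set \<Rightarrow> ('a \<Rightarrow> 'a) set \<Rightarrow> 'a \<Rightarrow> ('a \<Rightarrow> 'a) set" where
  "pt_stab \<Omega> H \<omega> = stabilizer (perm_group \<Omega> H) (\<lambda>h. h) \<omega>"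

definition set_stab :: "'a set \<Rightarrow> ('a \<Rightarrow> 'a) set \<Rightarrow> 'a set \<Rightarrow> ('a \<Rightarrow> 'a) set" where
  "set_stab \<Omega> H \<gamma> = stabilizer (perm_group \<Omega> H) (\<lambda>h X. h ` X) \<gamma>"

definition conj_set :: "('g, 'b) monoid_scheme \<Rightarrow> 'g set \<Rightarrow> 'g \<Rightarrow> 'g set" where
  "conj_set S A g = g <#\<^bsub>S\<^esub> A #>\<^bsub>S\<^esub> (inv\<^bsub>S\<^esub> g)"

definition conjugate_under :: "('g, 'b) monoid_scheme \<Rightarrow> 'g set \<Rightarrow> 'g set \<Rightarrow> 'g set \<Rightarrow> bool" where
  "conjugate_under S H A B \<longleftrightarrow> (\<exists>h\<in>H. conj_set S A h = B)"

definition minimal_normal :: "'g set \<Rightarrow> ('g, 'b) monoid_scheme \<Rightarrow> bool" where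
  "minimal_normal N S \<longleftrightarrow> N \<lhd> S \<and> N \<noteq> {\<one>\<^bsub>S\<^esub>} \<and>
     (\<forall>L. L \<lhd> S \<longrightarrow> L \<subseteq> N \<longrightarrow> L = {\<one>\<^bsub>S\<^esub>} \<or> L = N)"

definition plinth :: "'a set \<Rightarrow> ('a \<Rightarrow> 'a) set \<Rightarrow> ('a \<Rightarrow> 'a) set \<Rightarrow> bool" where
  "plinth \<Omega> G M \<longleftrightarrow> minimal_normal M (perm_group \<Omega> G) \<and>
     transitive_action (perm_group \<Omega> M) \<Omega> (\<lambda>m. m)"

definition innately_transitive :: "'a set \<Rightarrow> ('a \<Rightarrow> 'a) set \<Rightarrow> bool" where
  "innately_transitive \<Omega> G \<longleftrightarrow> subgroup G (BijGroup \<Omega>) \<and> (\<exists>M. plinth \<Omega> G M)"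

section \<open>Direct decompositions\<close>

text \<open>The set product \<open>X j\<^sub>1 \<cdots> X j\<^sub>r\<close> along the list \<open>[j\<^sub>1, \<dots>, j\<^sub>r]\<close>.\<close>

definition prod_sets :: "('g, 'b) monoid_scheme \<Rightarrow> (nat \<Rightarrow> 'g set) \<Rightarrow> nat list \<Rightarrow> 'g set" where
  "prod_sets S X js = foldr (\<lambda>j Y. X j <#>\<^bsub>S\<^esub> Y) js {\<one>\<^bsub>S\<^esub>}"

abbreviation full_prod :: "('g, 'b) monoid_scheme \<Rightarrow> (nat \<Rightarrow> 'g set) \<Rightarrow> nat \<Rightarrow> 'g set" where
  "full_prod S X k \<equiv> prod_sets S X [1..<Suc k]"

abbreviation co_prod :: "('g, 'b) monoid_scheme \<Rightarrow> (nat \<Rightarrow> 'g set) \<Rightarrow> nat \<Rightarrow> nat \<Rightarrow> 'g set" where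
  "co_prod S X k i \<equiv> prod_sets S X (removeAll i [1..<Suc k])"

definition internal_direct_product ::
    "('g, 'b) monoid_scheme \<Rightarrow> 'g set \<Rightarrow> (nat \<Rightarrow> 'g set) \<Rightarrow> nat \<Rightarrow> bool" where
  "internal_direct_product S M T k \<longleftrightarrow>
     (\<forall>i\<in>{1..k}. T i \<lhd> S \<lparr>carrier := M\<rparr>) \<and>
     M = full_prod S T k \<and>
     (\<forall>i\<in>{1..k}. T i \<inter> co_prod S T k i = {\<one>\<^bsub>S\<^esub>})"

definition simple_direct_factors ::
    "('g, 'b) monoid_scheme \<Rightarrow> 'g set \<Rightarrow> (nat \<Rightarrow> 'g set) \<Rightarrow> nat \<Rightarrow> bool" where
  "simple_direct_factors S M T k \<longleftrightarrow> internal_direct_product S M T k \<and>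
     (\<forall>i\<in>{1..k}. simple_group (S \<lparr>carrier := T i\<rparr>))"

text \<open>The projection \<open>\<sigma>\<^sub>i : M \<rightarrow> T\<^sub>i\<close>.\<close>

definition proj :: "('g, 'b) monoid_scheme \<Rightarrow> (nat \<Rightarrow> 'g set) \<Rightarrow> nat \<Rightarrow> nat \<Rightarrow> 'g \<Rightarrow> 'g" where
  "proj S T k i m = (THE t. t \<in> T i \<and> (\<exists>c \<in> co_prod S T k i. m = t \<otimes>\<^bsub>S\<^esub> c))"

section \<open>Cartesian decompositions and Cartesian systems\<close>

text \<open>A partition of \<open>\<Omega>\<close> is proper if it is not \<open>{\<Omega>}\<close>; these partitions correspond to the
  proper subgroups in a Cartesian system.\<close>

definition cartesian_decomposition :: "'a set \<Rightarrow> 'a set set set \<Rightarrow> bool" where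
  "cartesian_decomposition \<Omega> \<E> \<longleftrightarrow> finite \<E> \<and> \<E> \<noteq> {} \<and>
     (\<forall>P\<in>\<E>. partition_on \<Omega> P \<and> P \<noteq> {\<Omega>}) \<and>
     (\<forall>\<gamma>. (\<forall>P\<in>\<E>. \<gamma> P \<in> P) \<longrightarrow> card (\<Inter>P\<in>\<E>. \<gamma> P) = 1)"

definition partition_image :: "('a \<Rightarrow> 'a) \<Rightarrow> 'a set set \<Rightarrow> 'a set set" where
  "partition_image g P = (\<lambda>\<gamma>. g ` \<gamma>) ` P"

definition CD_tr :: "'a set \<Rightarrow> ('a \<Rightarrow> 'a) set \<Rightarrow> 'a set set set set" where
  "CD_tr \<Omega> G = {\<E>. cartesian_decomposition \<Omega> \<E> \<and>
     (\<forall>g\<in>G. \<forall>P\<in>\<E>. partition_image g P \<in> \<E>) \<and>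
     (\<forall>P\<in>\<E>. \<forall>Q\<in>\<E>. \<exists>g\<in>G. partition_image g P = Q)}"

text \<open>The term \<open>M \<inter> \<dots>\<close> makes the empty intersection of subgroups of \<open>M\<close> equal to \<open>M\<close>.\<close>

definition cartesian_system ::
    "'a set \<Rightarrow> ('a \<Rightarrow> 'a) set \<Rightarrow> 'a \<Rightarrow> ('a \<Rightarrow> 'a) set set \<Rightarrow> bool" where
  "cartesian_system \<Omega> M \<omega> \<K> \<longleftrightarrow> finite \<K> \<and> \<K> \<noteq> {} \<and>
     (\<forall>K\<in>\<K>. subgroup K (perm_group \<Omega> M) \<and> K \<noteq> M) \<and>
     \<Inter>\<K> = pt_stab \<Omega> M \<omega> \<and>
     (\<forall>K\<in>\<K>. K <#>\<^bsub>BijGroup \<Omega>\<^esub> (M \<inter> \<Inter>(\<K> - {K})) = M)"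

definition system_of ::
    "'a set \<Rightarrow> ('a \<Rightarrow> 'a) set \<Rightarrow> 'a \<Rightarrow> 'a set set set \<Rightarrow> ('a \<Rightarrow> 'a) set set" where
  "system_of \<Omega> M \<omega> \<E> = {set_stab \<Omega> M \<gamma> | P \<gamma>. P \<in> \<E> \<and> \<gamma> \<in> P \<and> \<omega> \<in> \<gamma>}"

definition decomposition_of ::
    "'a set \<Rightarrow> ('a \<Rightarrow> 'a) set \<Rightarrow> 'a \<Rightarrow> ('a \<Rightarrow> 'a) set set \<Rightarrow> 'a set set set" where
  "decomposition_of \<Omega> M \<omega> \<K> =
     {{m ` orbit (perm_group \<Omega> K) (\<lambda>h. h) \<omega> | m. m \<in> M} | K. K \<in> \<K>}"

definition F_set ::
    "'a set \<Rightarrow> ('a \<Rightarrow> 'a) set \<Rightarrow> (nat \<Rightarrow> ('a \<Rightarrow> 'a) set) \<Rightarrow> nat \<Rightarrow> 'a \<Rightarrow> 'a set set set \<Rightarrow> nat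
      \<Rightarrow> ('a \<Rightarrow> 'a) set set" where
  "F_set \<Omega> M T k \<omega> \<E> i =
     {proj (BijGroup \<Omega>) T k i ` K | K. K \<in> system_of \<Omega> M \<omega> \<E> \<and> proj (BijGroup \<Omega>) T k i ` K \<noteq> T i}"

definition CD_2_nonconj ::
    "'a set \<Rightarrow> ('a \<Rightarrow> 'a) set \<Rightarrow> ('a \<Rightarrow> 'a) set \<Rightarrow> (nat \<Rightarrow> ('a \<Rightarrow> 'a) set) \<Rightarrow> nat \<Rightarrow> 'a
      \<Rightarrow> 'a set set set set" where
  "CD_2_nonconj \<Omega> G M T k \<omega> = {\<E> \<in> CD_tr \<Omega> G. \<forall>i\<in>{1..k}.
     card (F_set \<Omega> M T k \<omega> \<E> i) = 2 \<and>
     (\<forall>A \<in> F_set \<Omega> M T k \<omega> \<E> i. \<forall>B \<in> F_set \<Omega> M T k \<omega> \<E> i. A \<noteq> B \<longrightarrow>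
        \<not> conjugate_under (BijGroup \<Omega>) (pt_stab \<Omega> G \<omega>) A B)}"

section \<open>Generalised di-graphs\<close>

text \<open>The maps \<open>\<beta>\<close>, \<open>\<epsilon>\<close> are \<^const>\<open>tail\<close>, \<^const>\<open>head\<close>. Vertices and arcs carry separate types,
  so their disjointness is implicit; when the two types coincide it has to be stated in addition.\<close>

definition gen_digraph :: "('v, 'e) pre_digraph \<Rightarrow> bool" where
  "gen_digraph \<Gamma> \<longleftrightarrow> loopfree_digraph \<Gamma> \<and> verts \<Gamma> \<noteq> {}"

definition digraph_auts :: "('v, 'e) pre_digraph \<Rightarrow> (('v \<Rightarrow> 'v) \<times> ('e \<Rightarrow> 'e)) set" where
  "digraph_auts \<Gamma> = {(a, b). a \<in> Bij (verts \<Gamma>) \<and> b \<in> Bij (arcs \<Gamma>) \<and>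
     (\<forall>e \<in> arcs \<Gamma>. a (tail \<Gamma> e) = tail \<Gamma> (b e) \<and> a (head \<Gamma> e) = head \<Gamma> (b e))}"

definition identifies ::
    "('v \<Rightarrow> 'w) \<Rightarrow> ('v, 'e) pre_digraph \<Rightarrow> ('w, 'e) pre_digraph \<Rightarrow> bool" where
  "identifies f \<Gamma> \<Delta> \<longleftrightarrow> bij_betw f (verts \<Gamma>) (verts \<Delta>) \<and> arcs \<Delta> = arcs \<Gamma> \<and>
     (\<forall>e \<in> arcs \<Gamma>. tail \<Delta> e = f (tail \<Gamma> e) \<and> head \<Delta> e = f (head \<Gamma> e))"

text \<open>\<open>end_at \<dots> C \<E> i K\<close>: \<open>K\<close> belongs to \<open>\<K>\<^sub>\<omega>(\<E>)\<close> and \<open>\<sigma>\<^sub>i(K)\<close> is \<open>G\<^sub>\<omega>\<close>-conjugate to \<open>C\<close>.\<close>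

definition end_at ::
    "'a set \<Rightarrow> ('a \<Rightarrow> 'a) set \<Rightarrow> ('a \<Rightarrow> 'a) set \<Rightarrow> (nat \<Rightarrow> ('a \<Rightarrow> 'a) set) \<Rightarrow> nat \<Rightarrow> 'a
      \<Rightarrow> ('a \<Rightarrow> 'a) set \<Rightarrow> 'a set set set \<Rightarrow> nat \<Rightarrow> ('a \<Rightarrow> 'a) set \<Rightarrow> bool" where
  "end_at \<Omega> G M T k \<omega> C \<E> i K \<longleftrightarrow> K \<in> system_of \<Omega> M \<omega> \<E> \<and>
     conjugate_under (BijGroup \<Omega>) (pt_stab \<Omega> G \<omega>) (proj (BijGroup \<Omega>) T k i ` K) C"

text \<open>\<open>\<Gamma>(G,\<E>)\<close>, with respect to the ordering \<open>A, B\<close> of the two members of \<open>\<F>\<^sub>1\<close>.\<close>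

definition digraph_of ::
    "'a set \<Rightarrow> ('a \<Rightarrow> 'a) set \<Rightarrow> ('a \<Rightarrow> 'a) set \<Rightarrow> (nat \<Rightarrow> ('a \<Rightarrow> 'a) set) \<Rightarrow> nat \<Rightarrow> 'a
      \<Rightarrow> ('a \<Rightarrow> 'a) set \<Rightarrow> ('a \<Rightarrow> 'a) set \<Rightarrow> 'a set set set
      \<Rightarrow> (('a \<Rightarrow> 'a) set, ('a \<Rightarrow> 'a) set) pre_digraph" where
  "digraph_of \<Omega> G M T k \<omega> A B \<E> =
     \<lparr>verts = system_of \<Omega> M \<omega> \<E>,
      arcs = T ` {1..k},
      tail = (\<lambda>S. THE K. \<exists>i\<in>{1..k}. S = T i \<and> end_at \<Omega> G M T k \<omega> A \<E> i K),
      head = (\<lambda>S. THE K. \<exists>i\<in>{1..k}. S = T i \<and> end_at \<Omega> G M T k \<omega> B \<E> i K)\<rparr>"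

section \<open>The subgroups attached to the vertices\<close>

definition transporters ::
    "'a set \<Rightarrow> ('a \<Rightarrow> 'a) set \<Rightarrow> (nat \<Rightarrow> ('a \<Rightarrow> 'a) set) \<Rightarrow> nat \<Rightarrow> 'a \<Rightarrow> (nat \<Rightarrow> 'a \<Rightarrow> 'a) \<Rightarrow> bool" where
  "transporters \<Omega> G T k \<omega> g \<longleftrightarrow>
     (\<forall>i\<in>{1..k}. g i \<in> pt_stab \<Omega> G \<omega> \<and> conj_set (BijGroup \<Omega>) (T 1) (g i) = T i)"

definition vertex_factor ::
    "'a set \<Rightarrow> (nat \<Rightarrow> ('a \<Rightarrow> 'a) set) \<Rightarrow> ('a \<Rightarrow> 'a) set \<Rightarrow> ('a \<Rightarrow> 'a) set
      \<Rightarrow> ('v, ('a \<Rightarrow> 'a) set) pre_digraph \<Rightarrow> (nat \<Rightarrow> 'a \<Rightarrow> 'a) \<Rightarrow> 'v \<Rightarrow> nat \<Rightarrow> ('a \<Rightarrow> 'a) set" where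
  "vertex_factor \<Omega> T A B \<Gamma> g v i =
     (if tail \<Gamma> (T i) = v then conj_set (BijGroup \<Omega>) A (g i)
      else if head \<Gamma> (T i) = v then conj_set (BijGroup \<Omega>) B (g i)
      else T i)"

definition vertex_subgroup ::
    "'a set \<Rightarrow> (nat \<Rightarrow> ('a \<Rightarrow> 'a) set) \<Rightarrow> nat \<Rightarrow> ('a \<Rightarrow> 'a) set \<Rightarrow> ('a \<Rightarrow> 'a) set
      \<Rightarrow> ('v, ('a \<Rightarrow> 'a) set) pre_digraph \<Rightarrow> (nat \<Rightarrow> 'a \<Rightarrow> 'a) \<Rightarrow> 'v \<Rightarrow> ('a \<Rightarrow> 'a) set" where
  "vertex_subgroup \<Omega> T k A B \<Gamma> g v = full_prod (BijGroup \<Omega>) (vertex_factor \<Omega> T A B \<Gamma> g v) k"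

end

(*
  The direct product M = T_1 x ... x T_k is determined by its coordinate projections, so everything
  about the groups K_v can be read off coordinate by coordinate.  In the i-th coordinate exactly
  the tail and the head of T_i contribute a proper factor, namely A_i and B_i; hence A_i B_i = T_i
  gives the factorisations K_v (intersection of the others) = M, and A_i, B_i intersecting in
  sigma_i(M_omega) gives the intersection condition.  G_omega permutes the T_i, and hypothesis (iv)
  says that it permutes the A_i and the B_i in the same way; since it acts on the graph by
  automorphisms, it permutes the K_v as it permutes the vertices.  Vertex-transitivity
  makes every vertex the tail of an arc, so that v can be recovered from K_v.  Comparing orders shows
  that T_i is not conjugate to A_1 or B_1, so the digraph attached to the decomposition is Gamma.
*)
theory Submission
  imports Defs
begin

section \<open>Conjugation\<close>

text \<open>Hypothesis (iv) enters through one observation: if two elements of G_\<omega> carry T_1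
  to the same factor, their quotient normalises T_1, hence also A_1 and B_1. This yields both the
  independence of the chosen g_i and the equivariance of the families A_i and B_i. The decomposition
  must be invariant under all of G, while the data are controlled only under G_\<omega>. Since M is
  transitive, G is the product of M and G_\<omega>; elements of M merely permute the blocks of each
  partition (\<omega>^K)^m, so only conjugation by G_\<omega> moves the partitions. The sets F_i and
  the digraph are defined from the decomposition, not from the K_v. They can be computed because the
  system recovered from E(K) is K again, and this is proved here along with the passage from systems
  to decompositions. The intersection of the K_v is automatically a direct product of subgroups of
  the T_i; it equals M_\<omega> because M_\<omega> is assumed to be the product of its
  projections.\<close>

lemma (in group) conj_set_eq_image:
  "conj_set G A g = (\<lambda>a. g \<otimes> a \<otimes> inv g) ` A"
  by (auto simp: conj_set_def l_coset_def r_coset_def)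

lemma (in group) conj_set_mult:
  assumes "g \<in> carrier G" "h \<in> carrier G" "A \<subseteq> carrier G"
  shows "conj_set G (conj_set G A g) h = conj_set G A (h \<otimes> g)"
proof -
  have "h \<otimes> (g \<otimes> a \<otimes> inv g) \<otimes> inv h = h \<otimes> g \<otimes> a \<otimes> inv (h \<otimes> g)" if "a \<in> A" for a
    using assms that by (auto simp: m_assoc inv_mult_group)
  then show ?thesis by (simp add: conj_set_eq_image image_image)
qed

lemma (in group) conj_set_inv:
  assumes "g \<in> carrier G" "A \<subseteq> carrier G"
  shows "conj_set G (conj_set G A g) (inv g) = A" "conj_set G (conj_set G A (inv g)) g = A"
proof -
  have "conj_set G A \<one> = A" using assms by (auto simp: conj_set_eq_image subset_iff image_def)
  then show "conj_set G (conj_set G A g) (inv g) = A" "conj_set G (conj_set G A (inv g)) g = A"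
    using assms by (simp_all add: conj_set_mult)
qed

lemma (in group) conj_set_subset:
  assumes "g \<in> carrier G" "A \<subseteq> carrier G"
  shows "conj_set G A g \<subseteq> carrier G"
  using assms by (auto simp: conj_set_eq_image)

lemma (in group) inj_on_conj: "g \<in> carrier G \<Longrightarrow> inj_on (\<lambda>a. g \<otimes> a \<otimes> inv g) (carrier G)"
  by (intro inj_onI) simp

lemma (in group) conj_mult:
  assumes "g \<in> carrier G" "a \<in> carrier G" "b \<in> carrier G"
  shows "g \<otimes> (a \<otimes> b) \<otimes> inv g = (g \<otimes> a \<otimes> inv g) \<otimes> (g \<otimes> b \<otimes> inv g)"
proof -
  have "(g \<otimes> a \<otimes> inv g) \<otimes> (g \<otimes> b \<otimes> inv g) = g \<otimes> a \<otimes> (inv g \<otimes> g) \<otimes> b \<otimes> inv g"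
    using assms by (simp only: m_assoc m_closed inv_closed)
  then show ?thesis using assms by (simp add: m_assoc)
qed

lemma (in group) card_conj_set:
  assumes "g \<in> carrier G" "A \<subseteq> carrier G"
  shows "card (conj_set G A g) = card A"
  unfolding conj_set_eq_image using card_image inj_on_subset[OF inj_on_conj] assms by blast

lemma (in group) conj_set_Int:
  assumes "g \<in> carrier G" "A \<subseteq> carrier G" "B \<subseteq> carrier G"
  shows "conj_set G (A \<inter> B) g = conj_set G A g \<inter> conj_set G B g"
  unfolding conj_set_eq_image by (rule inj_on_image_Int[OF inj_on_conj]) (use assms in auto)

lemma (in group) conj_set_set_mult:
  assumes "g \<in> carrier G" "A \<subseteq> carrier G" "B \<subseteq> carrier G"
  shows "conj_set G (A <#> B) g = conj_set G A g <#> conj_set G B g"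
proof -
  have "g \<otimes> (a \<otimes> b) \<otimes> inv g = (g \<otimes> a \<otimes> inv g) \<otimes> (g \<otimes> b \<otimes> inv g)"
    if "a \<in> A" "b \<in> B" for a b
    using conj_mult assms that by blast
  then show ?thesis by (simp add: conj_set_eq_image set_mult_def image_UN)
qed

lemma (in group) subgroup_conj_set:
  assumes g: "g \<in> carrier G" and A: "subgroup A G"
  shows "subgroup (conj_set G A g) G"
proof (rule subgroupI)
  note sub = subgroup.subset[OF A]
  show "conj_set G A g \<subseteq> carrier G" by (rule conj_set_subset[OF g sub])
  show "conj_set G A g \<noteq> {}" using subgroup.one_closed[OF A] by (auto simp: conj_set_eq_image)
  fix x assume "x \<in> conj_set G A g"
  then obtain a where a: "a \<in> A" "x = g \<otimes> a \<otimes> inv g" by (auto simp: conj_set_eq_image)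
  have "a \<in> carrier G" using a sub by blast
  then have "inv x = g \<otimes> inv a \<otimes> inv g" using a g by (simp add: inv_mult_group m_assoc)
  then show "inv x \<in> conj_set G A g"
    using subgroup.m_inv_closed[OF A a(1)] by (simp add: conj_set_eq_image)
  fix y assume "y \<in> conj_set G A g"
  then obtain b where b: "b \<in> A" "y = g \<otimes> b \<otimes> inv g" by (auto simp: conj_set_eq_image)
  have "x \<otimes> y = g \<otimes> (a \<otimes> b) \<otimes> inv g" using a b sub g conj_mult by (simp add: subset_iff)
  then show "x \<otimes> y \<in> conj_set G A g"
    using subgroup.m_closed[OF A a(1) b(1)] by (simp add: conj_set_eq_image)
qed

lemma mem_normalizer_iff:
  assumes "h \<in> carrier S" "X \<subseteq> carrier S"
  shows "h \<in> normalizer S X \<longleftrightarrow> conj_set S X h = X"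
  using assms by (simp add: normalizer_def stabilizer_def conj_set_def)

lemma (in group) commutator_trivial_imp_commute:
  assumes "x \<in> carrier G" "y \<in> carrier G" "x \<otimes> y \<otimes> inv x \<otimes> inv y = \<one>"
  shows "x \<otimes> y = y \<otimes> x"
  using assms by (metis inv_closed inv_solve_right' l_one m_closed)

section \<open>Internal direct products\<close>

lemma prod_sets_Nil [simp]: "prod_sets S X [] = {\<one>\<^bsub>S\<^esub>}"
  and prod_sets_Cons [simp]: "prod_sets S X (j # js) = X j <#>\<^bsub>S\<^esub> prod_sets S X js"
  by (simp_all add: prod_sets_def)

lemma set_multI: "h \<in> H \<Longrightarrow> k \<in> K \<Longrightarrow> h \<otimes>\<^bsub>S\<^esub> k \<in> H <#>\<^bsub>S\<^esub> K"
  by (auto simp: set_mult_def)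

lemma set_multE:
  assumes "x \<in> H <#>\<^bsub>S\<^esub> K"
  obtains h k where "h \<in> H" "k \<in> K" "x = h \<otimes>\<^bsub>S\<^esub> k"
  using assms by (auto simp: set_mult_def)

text \<open>Applied to singletons, this later produces an element of \<open>M\<close> with
  prescribed coordinates.\<close>

lemma prod_sets_nonempty: "(\<And>j. j \<in> set js \<Longrightarrow> X j \<noteq> {}) \<Longrightarrow> prod_sets S X js \<noteq> {}"
proof (induction js)
  case (Cons j js)
  then have "X j \<noteq> {}" and "prod_sets S X js \<noteq> {}" by auto
  then show ?case using set_multI by fastforce
qed simp

locale direct_decomposition = group S
  for S :: "('g, 'b) monoid_scheme" (structure) +
  fixes M :: "'g set" and T :: "nat \<Rightarrow> 'g set" and k :: nat
  assumes subgroup_M: "subgroup M S"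
    and decomp: "internal_direct_product S M T k"
begin

text \<open>The list \<open>[1..<Suc k]\<close> stays folded, and its set simplifies to
  \<open>{1..k}\<close>, the form in which all index conditions are stated.\<close>

declare upt_Suc [simp del] atLeastLessThanSuc_atLeastAtMost [simp]

abbreviation \<sigma> :: "nat \<Rightarrow> 'g \<Rightarrow> 'g" where "\<sigma> \<equiv> proj S T k"

abbreviation P :: "nat list \<Rightarrow> 'g set" where "P \<equiv> prod_sets S T"

lemma group_M: "group (S\<lparr>carrier := M\<rparr>)"
  by (rule subgroup.subgroup_is_group[OF subgroup_M is_group])

lemma normal_T: "i \<in> {1..k} \<Longrightarrow> T i \<lhd> S\<lparr>carrier := M\<rparr>"
  using decomp unfolding internal_direct_product_def by blast

lemma M_eq: "M = P [1..<Suc k]"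
  using decomp by (simp add: internal_direct_product_def)

lemma T_co_prod: "i \<in> {1..k} \<Longrightarrow> T i \<inter> co_prod S T k i = {\<one>}"
  using decomp by (simp add: internal_direct_product_def)

lemma M_carrier: "x \<in> M \<Longrightarrow> x \<in> carrier S"
  using subgroup.subset[OF subgroup_M] by blast

lemma subgroup_T: "i \<in> {1..k} \<Longrightarrow> subgroup (T i) S"
  using incl_subgroup[OF subgroup_M] normal_T normal_imp_subgroup by blast

lemma T_subset_M: "i \<in> {1..k} \<Longrightarrow> T i \<subseteq> M"
  using normal_T[THEN normal_imp_subgroup, THEN subgroup.subset] by simp

lemma T_carrier: "i \<in> {1..k} \<Longrightarrow> x \<in> T i \<Longrightarrow> x \<in> carrier S"
  using T_subset_M M_carrier by blast

lemma one_in_T: "i \<in> {1..k} \<Longrightarrow> \<one> \<in> T i"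
  using subgroup.one_closed[OF subgroup_T] .

lemma T_conj:
  assumes "i \<in> {1..k}" "m \<in> M" "t \<in> T i"
  shows "m \<otimes> t \<otimes> inv m \<in> T i"
  using normal.inv_op_closed2[OF normal_T[OF assms(1)], of m t] assms
    m_inv_consistent[OF subgroup_M] by simp

section \<open>Products of direct factors along lists of indices\<close>

lemma one_in_P: "set js \<subseteq> {1..k} \<Longrightarrow> \<one> \<in> P js"
proof (induction js)
  case (Cons j js)
  then have "\<one> \<otimes> \<one> \<in> T j <#> P js" using one_in_T by (intro set_multI) auto
  then show ?case by simp
qed simp

lemma T_subset_P:
  assumes "set js \<subseteq> {1..k}" "i \<in> set js"
  shows "T i \<subseteq> P js"
  using assms
proof (induction js)
  case (Cons j js)
  show ?case
  proof
    fix t assume t: "t \<in> T i"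
    then have tc: "t \<in> carrier S" using Cons.prems T_carrier by blast
    show "t \<in> P (j # js)"
    proof (cases "i = j")
      case True
      then have "t \<otimes> \<one> \<in> T j <#> P js" using one_in_P[of js] t Cons.prems by (intro set_multI) auto
      then show ?thesis using tc by simp
    next
      case False
      then have "\<one> \<otimes> t \<in> T j <#> P js"
        using Cons one_in_T[of j] t by (intro set_multI) auto
      then show ?thesis using tc by simp
    qed
  qed
qed simp

text \<open>Directness is stated against the complementary product, which contains every other
  factor.\<close>

lemma T_Int:
  assumes "i \<in> {1..k}" "j \<in> {1..k}" "i \<noteq> j"
  shows "T i \<inter> T j = {\<one>}"
proof -
  have "T j \<subseteq> co_prod S T k i" using assms by (intro T_subset_P) auto
  then show ?thesis using T_co_prod[OF assms(1)] one_in_T assms by blast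
qed

text \<open>Both factors are normal in \<open>M\<close>, so the commutator lies in each of them and
  hence in their trivial intersection.\<close>

lemma T_commute:
  assumes "i \<in> {1..k}" "j \<in> {1..k}" "i \<noteq> j" "x \<in> T i" "y \<in> T j"
  shows "x \<otimes> y = y \<otimes> x"
proof (rule commutator_trivial_imp_commute)
  note M = T_subset_M[OF assms(1)] T_subset_M[OF assms(2)]
  show c: "x \<in> carrier S" "y \<in> carrier S" using T_carrier assms by auto
  have "x \<otimes> y \<otimes> inv x \<in> T j" using T_conj assms M by blast
  then have 1: "x \<otimes> y \<otimes> inv x \<otimes> inv y \<in> T j"
    using subgroup_T assms by (simp add: subgroup.m_closed subgroup.m_inv_closed)
  have "y \<otimes> inv x \<otimes> inv y \<in> T i"
    using T_conj assms M subgroup.m_inv_closed[OF subgroup_T] by blast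
  then have "x \<otimes> (y \<otimes> inv x \<otimes> inv y) \<in> T i"
    using subgroup_T assms by (simp add: subgroup.m_closed)
  then have "x \<otimes> y \<otimes> inv x \<otimes> inv y \<in> T i" using c by (simp add: m_assoc)
  then show "x \<otimes> y \<otimes> inv x \<otimes> inv y = \<one>" using 1 T_Int[OF assms(1-3)] by blast
qed

lemma P_carrier: "set js \<subseteq> {1..k} \<Longrightarrow> x \<in> P js \<Longrightarrow> x \<in> carrier S"
  by (induction js arbitrary: x) (auto elim!: set_multE simp: T_carrier)

lemma T_P_commute:
  assumes "i \<in> {1..k}" "set js \<subseteq> {1..k}" "i \<notin> set js" "x \<in> T i" "p \<in> P js"
  shows "x \<otimes> p = p \<otimes> x"
  using assms(2,3,5)
proof (induction js arbitrary: p)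
  case Nil
  then show ?case using T_carrier assms by simp
next
  case (Cons j js)
  then obtain t q where tq: "t \<in> T j" "q \<in> P js" "p = t \<otimes> q" by (auto elim!: set_multE)
  have c: "t \<in> carrier S" "q \<in> carrier S" "x \<in> carrier S"
    using tq T_carrier[of j t] T_carrier[of i x] P_carrier[of js q] Cons.prems assms by auto
  have "x \<otimes> p = x \<otimes> t \<otimes> q" using tq c by (simp add: m_assoc)
  also have "x \<otimes> t = t \<otimes> x" using T_commute[of i j] Cons.prems assms tq by auto
  also have "t \<otimes> x \<otimes> q = t \<otimes> (x \<otimes> q)" using c by (simp add: m_assoc)
  also have "x \<otimes> q = q \<otimes> x" using Cons tq by auto
  finally show ?case using tq c by (simp add: m_assoc)
qed

text \<open>In a list without repetitions the first factor commutes elementwise with the product of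
  the others, so products and inverses can be sorted back into list order.\<close>

lemma subgroup_P:
  assumes "set js \<subseteq> {1..k}" "distinct js"
  shows "subgroup (P js) S"
  using assms
proof (induction js)
  case Nil
  then show ?case using triv_subgroup by simp
next
  case (Cons j js)
  then have j: "j \<in> {1..k}" "j \<notin> set js" "set js \<subseteq> {1..k}" and sub: "subgroup (P js) S" by auto
  note T = subgroup_T[OF j(1)]
  show ?case
  proof (rule subgroupI)
    show "P (j # js) \<subseteq> carrier S" using P_carrier[of "j # js"] Cons.prems by blast
    show "P (j # js) \<noteq> {}" using one_in_P[of "j # js"] Cons.prems by blast
    fix a assume "a \<in> P (j # js)"
    then obtain t q where a: "t \<in> T j" "q \<in> P js" "a = t \<otimes> q" by (auto elim!: set_multE)
    note c = T_carrier[OF j(1) a(1)] P_carrier[OF j(3) a(2)]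
    have i: "inv t \<in> T j" "inv q \<in> P js" using a T sub by (auto intro: subgroup.m_inv_closed)
    have "inv a = inv q \<otimes> inv t" using a c by (simp add: inv_mult_group)
    also have "\<dots> = inv t \<otimes> inv q" using T_P_commute[OF j(1,3,2) i] by simp
    finally show "inv a \<in> P (j # js)" using i set_multI by fastforce
    fix b assume "b \<in> P (j # js)"
    then obtain t' q' where b: "t' \<in> T j" "q' \<in> P js" "b = t' \<otimes> q'" by (auto elim!: set_multE)
    note c' = T_carrier[OF j(1) b(1)] P_carrier[OF j(3) b(2)]
    have "a \<otimes> b = t \<otimes> (q \<otimes> t') \<otimes> q'" using a b c c' by (simp add: m_assoc)
    also have "q \<otimes> t' = t' \<otimes> q" using T_P_commute[OF j(1,3,2) b(1) a(2)] by simp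
    also have "t \<otimes> (t' \<otimes> q) \<otimes> q' = (t \<otimes> t') \<otimes> (q \<otimes> q')" using c c' by (simp add: m_assoc)
    finally show "a \<otimes> b \<in> P (j # js)"
      using a b T sub by (auto intro!: set_multI subgroup.m_closed)
  qed
qed

text \<open>Each factor listed in \<open>js\<close> lies in the subgroup \<open>P js'\<close>, so
  inclusions can be read off from the index sets, whatever the order of the lists.\<close>

lemma P_mono:
  assumes "set js \<subseteq> set js'" "set js' \<subseteq> {1..k}" "distinct js'"
  shows "P js \<subseteq> P js'"
  using assms(1)
proof (induction js)
  case Nil
  then show ?case using one_in_P assms by simp
next
  case (Cons j js)
  show ?case
  proof
    fix x assume "x \<in> P (j # js)"
    then obtain t q where t: "t \<in> T j" and q: "q \<in> P js" and x: "x = t \<otimes> q"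
      by (auto elim!: set_multE)
    have "t \<in> P js'" using T_subset_P[OF assms(2), of j] Cons.prems t by auto
    moreover have "q \<in> P js'" using Cons q by auto
    ultimately show "x \<in> P js'"
      using subgroup.m_closed[OF subgroup_P[OF assms(2,3)]] x by simp
  qed
qed

lemma P_subset_M: "set js \<subseteq> {1..k} \<Longrightarrow> P js \<subseteq> M"
  using P_mono[of js "[1..<Suc k]"] M_eq by auto

lemma co_subgroup: "subgroup (co_prod S T k i) S"
  by (rule subgroup_P) (auto simp: distinct_removeAll)

lemma co_carrier: "c \<in> co_prod S T k i \<Longrightarrow> c \<in> carrier S"
  using co_subgroup subgroup.subset by blast

text \<open>The components standing before the one in \<open>T i\<close> commute with it, so it can
  be pulled to the front.\<close>

lemma split_off:
  assumes "distinct js" "set js \<subseteq> {1..k}" "i \<in> set js" "m \<in> P js"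
  shows "\<exists>t\<in>T i. \<exists>c\<in>P (removeAll i js). m = t \<otimes> c"
  using assms
proof (induction js arbitrary: m)
  case (Cons j js)
  then obtain t q where a: "t \<in> T j" "q \<in> P js" "m = t \<otimes> q" by (auto elim!: set_multE)
  have ct: "t \<in> carrier S" using a Cons.prems T_carrier[of j t] by auto
  show ?case
  proof (cases "i = j")
    case True
    then show ?thesis using a Cons.prems by (auto simp: removeAll_id)
  next
    case False
    then obtain t' c where b: "t' \<in> T i" "c \<in> P (removeAll i js)" "q = t' \<otimes> c"
      using Cons.IH[of q] Cons.prems False a(2) by auto
    have c: "t' \<in> carrier S" "c \<in> carrier S"
      using b Cons.prems False T_carrier[of i t'] P_carrier[of "removeAll i js" c] by auto
    have "m = t \<otimes> t' \<otimes> c" using a b c ct by (simp add: m_assoc)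
    also have "t \<otimes> t' = t' \<otimes> t" using T_commute[of j i] False a b Cons.prems by auto
    finally have "m = t' \<otimes> (t \<otimes> c)" using c ct by (simp add: m_assoc)
    moreover have "t \<otimes> c \<in> P (removeAll i (j # js))" using False a b by (auto intro: set_multI)
    ultimately show ?thesis using b by blast
  qed
qed simp

section \<open>Projections onto the direct factors\<close>

lemma split_M:
  assumes "i \<in> {1..k}" "m \<in> M"
  obtains t c where "t \<in> T i" "c \<in> co_prod S T k i" "m = t \<otimes> c"
  using split_off[of "[1..<Suc k]" i m] assms M_eq by auto

text \<open>Two such splittings differ by an element of \<open>T i\<close> that also lies in the
  complementary product, hence by the identity. This justifies the definite description in
  \<open>proj\<close>.\<close>

lemma proj_mult:
  assumes i: "i \<in> {1..k}" and t: "t \<in> T i" and c: "c \<in> co_prod S T k i"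
  shows "\<sigma> i (t \<otimes> c) = t"
  unfolding proj_def
proof (rule the_equality)
  show "t \<in> T i \<and> (\<exists>c'\<in>co_prod S T k i. t \<otimes> c = t \<otimes> c')" using t c by auto
  fix t' assume "t' \<in> T i \<and> (\<exists>c'\<in>co_prod S T k i. t \<otimes> c = t' \<otimes> c')"
  then obtain c' where t': "t' \<in> T i" and c': "c' \<in> co_prod S T k i" and eq: "t \<otimes> c = t' \<otimes> c'"
    by blast
  note cs = T_carrier[OF i t] T_carrier[OF i t'] co_carrier[OF c] co_carrier[OF c']
  have "inv t' \<otimes> t = inv t' \<otimes> (t \<otimes> c) \<otimes> inv c" using cs by (simp add: m_assoc)
  also have "\<dots> = c' \<otimes> inv c" using cs unfolding eq by (simp add: m_assoc[symmetric])
  finally have "inv t' \<otimes> t = c' \<otimes> inv c" .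
  moreover have "inv t' \<otimes> t \<in> T i"
    using t t' subgroup_T[OF i] by (simp add: subgroup.m_closed subgroup.m_inv_closed)
  moreover have "c' \<otimes> inv c \<in> co_prod S T k i"
    using c c' co_subgroup by (simp add: subgroup.m_closed subgroup.m_inv_closed)
  ultimately have "inv t' \<otimes> t = \<one>" using T_co_prod[OF i] by auto
  then show "t' = t" using cs by (metis inv_closed inv_equality inv_inv)
qed

lemma proj_closed: "i \<in> {1..k} \<Longrightarrow> m \<in> M \<Longrightarrow> \<sigma> i m \<in> T i"
  by (metis split_M proj_mult)

lemma proj_id:
  assumes "i \<in> {1..k}" "t \<in> T i"
  shows "\<sigma> i t = t"
  using proj_mult[OF assms subgroup.one_closed[OF co_subgroup]] T_carrier[OF assms] by simp

text \<open>The complementary part of \<open>m\<close> commutes with the \<open>T i\<close>-part of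
  \<open>n\<close>, so the two splittings multiply componentwise.\<close>

lemma proj_hom:
  assumes i: "i \<in> {1..k}" and m: "m \<in> M" "n \<in> M"
  shows "\<sigma> i (m \<otimes> n) = \<sigma> i m \<otimes> \<sigma> i n"
proof -
  obtain t c where a: "t \<in> T i" "c \<in> co_prod S T k i" "m = t \<otimes> c" using split_M[OF i m(1)] .
  obtain t' c' where b: "t' \<in> T i" "c' \<in> co_prod S T k i" "n = t' \<otimes> c'" using split_M[OF i m(2)] .
  have cs: "t \<in> carrier S" "c \<in> carrier S" "t' \<in> carrier S" "c' \<in> carrier S"
    using a b T_carrier[OF i] co_carrier by auto
  have "m \<otimes> n = t \<otimes> (c \<otimes> t') \<otimes> c'" using a b cs by (simp add: m_assoc)
  also have "c \<otimes> t' = t' \<otimes> c"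
    using T_P_commute[OF i _ _ b(1) a(2)] by auto
  also have "t \<otimes> (t' \<otimes> c) \<otimes> c' = (t \<otimes> t') \<otimes> (c \<otimes> c')" using cs by (simp add: m_assoc)
  finally have "\<sigma> i (m \<otimes> n) = t \<otimes> t'"
    using proj_mult[OF i] subgroup_T[OF i] co_subgroup a b by (simp add: subgroup.m_closed)
  then show ?thesis using a b proj_mult[OF i] by simp
qed

lemma proj_group_hom: "i \<in> {1..k} \<Longrightarrow> group_hom (S\<lparr>carrier := M\<rparr>) S (\<sigma> i)"
  using proj_hom proj_closed T_carrier group_M is_group
  by (auto simp: group_hom_def group_hom_axioms_def hom_def)

lemma proj_one: "i \<in> {1..k} \<Longrightarrow> \<sigma> i \<one> = \<one>"
  using proj_id one_in_T by blast

lemma proj_inv: "i \<in> {1..k} \<Longrightarrow> m \<in> M \<Longrightarrow> \<sigma> i (inv m) = inv (\<sigma> i m)"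
  using group_hom.hom_inv[OF proj_group_hom] m_inv_consistent[OF subgroup_M] by simp

lemma proj_co:
  assumes "i \<in> {1..k}" "c \<in> co_prod S T k i"
  shows "\<sigma> i c = \<one>"
  using proj_mult[OF assms(1) one_in_T[OF assms(1)] assms(2)] co_carrier[OF assms(2)] by simp

lemma proj_other:
  assumes "i \<in> {1..k}" "set js \<subseteq> {1..k}" "i \<notin> set js" "p \<in> P js"
  shows "\<sigma> i p = \<one>"
  using proj_co[OF assms(1)] P_mono[of js "removeAll i [1..<Suc k]"] assms
  by (auto simp: distinct_removeAll)

text \<open>Replaces an ordered product of sets by conditions on coordinates. In the induction the
  coordinate of the first factor sees only that factor, and the later coordinates see only the
  remaining product.\<close>

lemma proj_prod_sets:
  assumes "distinct js" "set js \<subseteq> {1..k}" "\<And>i. i \<in> set js \<Longrightarrow> X i \<subseteq> T i"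
  shows "prod_sets S X js = {m \<in> P js. \<forall>i\<in>set js. \<sigma> i m \<in> X i}"
  using assms
proof (induction js)
  case (Cons j js)
  have sub: "j \<in> {1..k}" "set js \<subseteq> {1..k}" "j \<notin> set js" using Cons.prems by auto
  have key: "(\<forall>i\<in>set (j # js). \<sigma> i (t \<otimes> q) \<in> X i) \<longleftrightarrow> t \<in> X j \<and> (\<forall>i\<in>set js. \<sigma> i q \<in> X i)"
    if t: "t \<in> T j" and q: "q \<in> P js" for t q
  proof -
    have M: "t \<in> M" "q \<in> M" using T_subset_M P_subset_M sub t q by auto
    have "\<sigma> j (t \<otimes> q) = t"
      using proj_hom[OF sub(1) M] proj_id[OF sub(1) t] proj_other[OF sub q] T_carrier[OF sub(1) t]
      by simp
    moreover have "\<sigma> i (t \<otimes> q) = \<sigma> i q" if i: "i \<in> set js" for i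
    proof -
      have i': "i \<in> {1..k}" using sub i by auto
      have "t \<in> P [j]" using t T_subset_P[of "[j]" j] sub by auto
      then have "\<sigma> i t = \<one>" using proj_other[of i "[j]"] i' i sub by auto
      then show ?thesis using proj_hom[OF i' M] proj_closed[OF i' M(2)] T_carrier[OF i'] by simp
    qed
    ultimately show ?thesis by simp
  qed
  have IH: "prod_sets S X js = {m \<in> P js. \<forall>i\<in>set js. \<sigma> i m \<in> X i}"
    using Cons by simp
  show ?case
  proof (intro subset_antisym subsetI)
    fix m assume "m \<in> prod_sets S X (j # js)"
    then obtain t q where "t \<in> X j" "q \<in> prod_sets S X js" and m: "m = t \<otimes> q"
      by (auto elim: set_multE)
    then have t: "t \<in> X j" "t \<in> T j" and q: "q \<in> P js" "\<forall>i\<in>set js. \<sigma> i q \<in> X i"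
      using IH Cons.prems(3)[of j] by auto
    have "m \<in> P (j # js)" using t q m by (auto intro: set_multI)
    then show "m \<in> {m \<in> P (j # js). \<forall>i\<in>set (j # js). \<sigma> i m \<in> X i}"
      using key[OF t(2) q(1)] t q m by simp
  next
    fix m assume "m \<in> {m \<in> P (j # js). \<forall>i\<in>set (j # js). \<sigma> i m \<in> X i}"
    then have "m \<in> P (j # js)" and s: "\<forall>i\<in>set (j # js). \<sigma> i m \<in> X i" by auto
    then obtain t q where t: "t \<in> T j" and q: "q \<in> P js" and m: "m = t \<otimes> q"
      by (auto elim: set_multE)
    show "m \<in> prod_sets S X (j # js)"
      using key[OF t q] s q unfolding m prod_sets_Cons IH by (blast intro: set_multI)
  qed
qed simp

section \<open>Elements and subgroups of \<open>M\<close> described by coordinates\<close>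

lemma full_prod_eq:
  assumes "\<And>i. i \<in> {1..k} \<Longrightarrow> X i \<subseteq> T i"
  shows "full_prod S X k = {m \<in> M. \<forall>i\<in>{1..k}. \<sigma> i m \<in> X i}"
proof -
  have "set [1..<Suc k] = {1..k}" by auto
  then show ?thesis using proj_prod_sets[of "[1..<Suc k]" X] assms M_eq by auto
qed

lemma exists_with_projs:
  assumes "\<And>i. i \<in> {1..k} \<Longrightarrow> f i \<in> T i"
  obtains m where "m \<in> M" "\<And>i. i \<in> {1..k} \<Longrightarrow> \<sigma> i m = f i"
proof -
  have "full_prod S (\<lambda>i. {f i}) k \<noteq> {}" by (rule prod_sets_nonempty) simp
  then show ?thesis using that full_prod_eq[of "\<lambda>i. {f i}"] assms by auto
qed

text \<open>The quotient has trivial coordinates, so it lies in the product of trivial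
  groups.\<close>

lemma eq_if_projs_eq:
  assumes m: "m \<in> M" "n \<in> M" and eq: "\<And>i. i \<in> {1..k} \<Longrightarrow> \<sigma> i m = \<sigma> i n"
  shows "m = n"
proof -
  have one: "prod_sets S (\<lambda>i. {\<one>}) js = {\<one>}" for js
    by (induction js) (auto simp: set_mult_def)
  have "inv n \<in> M" using m subgroup_M by (simp add: subgroup.m_inv_closed)
  then have "inv n \<otimes> m \<in> M" "\<And>i. i \<in> {1..k} \<Longrightarrow> \<sigma> i (inv n \<otimes> m) = \<one>"
    using m subgroup_M proj_hom proj_inv eq proj_closed T_carrier
    by (auto simp: subgroup.m_closed)
  then have "inv n \<otimes> m = \<one>"
    using full_prod_eq[of "\<lambda>i. {\<one>}"] one one_in_T by auto
  then show ?thesis using m M_carrier by (metis inv_closed inv_equality inv_inv)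
qed

lemma subgroup_full_prod:
  assumes "\<And>i. i \<in> {1..k} \<Longrightarrow> subgroup (X i) S" "\<And>i. i \<in> {1..k} \<Longrightarrow> X i \<subseteq> T i"
  shows "subgroup (full_prod S X k) S"
proof -
  have "full_prod S X k = {m \<in> M. \<forall>i\<in>{1..k}. \<sigma> i m \<in> X i}"
    using assms by (intro full_prod_eq) auto
  moreover have "subgroup {m \<in> M. \<forall>i\<in>{1..k}. \<sigma> i m \<in> X i} S"
    using assms(1) subgroup_M M_carrier proj_one proj_hom proj_inv
    by (intro subgroupI)
      (auto simp: subgroup.m_closed subgroup.m_inv_closed intro!: exI[of _ \<one>] subgroup.one_closed)
  ultimately show ?thesis by simp
qed

text \<open>Because the other \<open>X j\<close> are nonempty, any prescribed value in coordinate
  \<open>i\<close> can be completed to an element of the product.\<close>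

lemma proj_image_full_prod:
  assumes "\<And>i. i \<in> {1..k} \<Longrightarrow> X i \<subseteq> T i" "\<And>i. i \<in> {1..k} \<Longrightarrow> X i \<noteq> {}" and i: "i \<in> {1..k}"
  shows "\<sigma> i ` full_prod S X k = X i"
proof
  have eq: "full_prod S X k = {m \<in> M. \<forall>i\<in>{1..k}. \<sigma> i m \<in> X i}"
    using assms by (intro full_prod_eq) auto
  show "\<sigma> i ` full_prod S X k \<subseteq> X i" using i unfolding eq by auto
  show "X i \<subseteq> \<sigma> i ` full_prod S X k"
  proof
    fix x assume x: "x \<in> X i"
    define f where "f = (\<lambda>j. if j = i then x else SOME y. y \<in> X j)"
    have f: "f j \<in> X j" if "j \<in> {1..k}" for j
      using x assms(2)[OF that] by (auto simp: f_def some_in_eq)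
    then obtain m where "m \<in> M" "\<And>i. i \<in> {1..k} \<Longrightarrow> \<sigma> i m = f i"
      using assms(1) exists_with_projs[of f] by blast
    then have "m \<in> full_prod S X k" "\<sigma> i m = x" using f i unfolding eq by (auto simp: f_def)
    then show "x \<in> \<sigma> i ` full_prod S X k" by blast
  qed
qed

text \<open>By \<open>perm\<close>, the factors other than \<open>T i\<close> are conjugated to
  factors other than \<open>T j\<close>, so a product avoiding \<open>T i\<close> is conjugated,
  factor by factor, into the complement of \<open>T j\<close>.\<close>

lemma P_conj:
  assumes h: "h \<in> carrier S"
    and perm: "\<And>l. l \<in> {1..k} \<Longrightarrow> l \<noteq> i \<Longrightarrow> \<exists>l'\<in>{1..k}. l' \<noteq> j \<and> conj_set S (T l) h = T l'"
    and js: "set js \<subseteq> {1..k}" "i \<notin> set js" and p: "p \<in> P js"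
  shows "h \<otimes> p \<otimes> inv h \<in> co_prod S T k j"
  using js p
proof (induction js arbitrary: p)
  case Nil
  then show ?case using h subgroup.one_closed[OF co_subgroup] by simp
next
  case (Cons l js)
  then obtain t q where a: "t \<in> T l" "q \<in> P js" "p = t \<otimes> q" by (auto elim!: set_multE)
  have c: "t \<in> carrier S" "q \<in> carrier S"
    using a Cons.prems T_carrier[of l t] P_carrier[of js q] by auto
  obtain l' where l': "l' \<in> {1..k}" "l' \<noteq> j" "conj_set S (T l) h = T l'"
    using perm[of l] Cons.prems by auto
  then have "h \<otimes> t \<otimes> inv h \<in> T l'" using a(1) by (auto simp: conj_set_eq_image)
  moreover have "T l' \<subseteq> co_prod S T k j" using l' by (intro T_subset_P) auto
  ultimately have "h \<otimes> t \<otimes> inv h \<in> co_prod S T k j" by blast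
  moreover have "h \<otimes> q \<otimes> inv h \<in> co_prod S T k j" using Cons a by auto
  moreover have "h \<otimes> p \<otimes> inv h = (h \<otimes> t \<otimes> inv h) \<otimes> (h \<otimes> q \<otimes> inv h)"
    using conj_mult[OF h c] a(3) by simp
  ultimately show ?case using subgroup.m_closed[OF co_subgroup] by simp
qed

text \<open>Conjugation by \<open>h\<close> respects the splitting that defines the projections:
  \<open>T i\<close> goes to \<open>T j\<close>, and the complement of the one into the complement
  of the other.\<close>

lemma proj_conj:
  assumes h: "h \<in> carrier S" and i: "i \<in> {1..k}" and j: "j \<in> {1..k}"
    and ij: "conj_set S (T i) h = T j"
    and perm: "\<And>l. l \<in> {1..k} \<Longrightarrow> l \<noteq> i \<Longrightarrow> \<exists>l'\<in>{1..k}. l' \<noteq> j \<and> conj_set S (T l) h = T l'"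
    and m: "m \<in> M"
  shows "\<sigma> j (h \<otimes> m \<otimes> inv h) = h \<otimes> \<sigma> i m \<otimes> inv h"
proof -
  obtain t c where a: "t \<in> T i" "c \<in> co_prod S T k i" "m = t \<otimes> c" using split_M[OF i m] .
  have cs: "t \<in> carrier S" "c \<in> carrier S" using a T_carrier[OF i] co_carrier by auto
  have "h \<otimes> c \<otimes> inv h \<in> co_prod S T k j"
    using a(2) by (intro P_conj[OF h perm]) auto
  moreover have "h \<otimes> t \<otimes> inv h \<in> T j" using a(1) ij by (auto simp: conj_set_eq_image)
  moreover have "h \<otimes> m \<otimes> inv h = (h \<otimes> t \<otimes> inv h) \<otimes> (h \<otimes> c \<otimes> inv h)"
    using conj_mult[OF h cs] a(3) by simp
  ultimately show ?thesis using proj_mult[OF j] proj_mult[OF i a(1,2)] a(3) by simp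
qed

end

section \<open>From Cartesian systems to Cartesian decompositions\<close>

lemma BijGroup_apply_mult:
  assumes "g \<in> carrier (BijGroup \<Omega>)" "h \<in> carrier (BijGroup \<Omega>)" "x \<in> \<Omega>"
  shows "(g \<otimes>\<^bsub>BijGroup \<Omega>\<^esub> h) x = g (h x)"
  using assms by (simp add: BijGroup_def compose_def)

lemma BijGroup_apply_one: "x \<in> \<Omega> \<Longrightarrow> \<one>\<^bsub>BijGroup \<Omega>\<^esub> x = x"
  by (simp add: BijGroup_def)

lemma BijGroup_image_one: "X \<subseteq> \<Omega> \<Longrightarrow> \<one>\<^bsub>BijGroup \<Omega>\<^esub> ` X = X"
  by (auto simp: BijGroup_def image_def)

lemma BijGroup_apply_closed:
  assumes "g \<in> carrier (BijGroup \<Omega>)" "x \<in> \<Omega>"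
  shows "g x \<in> \<Omega>"
proof -
  have "g \<in> Bij \<Omega>" using assms(1) by (simp add: BijGroup_def)
  then show ?thesis using Bij_imp_funcset assms(2) by blast
qed

lemma BijGroup_inv_apply:
  assumes "g \<in> carrier (BijGroup \<Omega>)" "x \<in> \<Omega>"
  shows "(inv\<^bsub>BijGroup \<Omega>\<^esub> g) (g x) = x"
proof -
  interpret S: group "BijGroup \<Omega>" by (rule group_BijGroup)
  show ?thesis
    using BijGroup_apply_mult[of "inv\<^bsub>BijGroup \<Omega>\<^esub> g" \<Omega> g x] assms
    by (simp add: BijGroup_apply_one)
qed

lemma pt_stab_eq: "pt_stab \<Omega> H \<omega> = {h \<in> H. h \<omega> = \<omega>}"
  by (simp add: pt_stab_def stabilizer_def)

lemma set_stab_eq: "set_stab \<Omega> H \<gamma> = {h \<in> H. h ` \<gamma> = \<gamma>}"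
  by (simp add: set_stab_def stabilizer_def)

lemma subgroup_pt_stab:
  assumes H: "subgroup H (BijGroup \<Omega>)" and \<omega>: "\<omega> \<in> \<Omega>"
  shows "subgroup (pt_stab \<Omega> H \<omega>) (BijGroup \<Omega>)"
proof -
  interpret S: group "BijGroup \<Omega>" by (rule group_BijGroup)
  have c: "h \<in> carrier (BijGroup \<Omega>)" if "h \<in> H" for h using H that subgroup.subset by blast
  show ?thesis
  proof (rule S.subgroupI)
    show "pt_stab \<Omega> H \<omega> \<subseteq> carrier (BijGroup \<Omega>)" using c by (auto simp: pt_stab_eq)
    show "pt_stab \<Omega> H \<omega> \<noteq> {}"
      using subgroup.one_closed[OF H] BijGroup_apply_one[OF \<omega>] by (auto simp: pt_stab_eq)
    fix a assume a: "a \<in> pt_stab \<Omega> H \<omega>"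
    then have aH: "a \<in> H" "a \<omega> = \<omega>" by (auto simp: pt_stab_eq)
    have "(inv\<^bsub>BijGroup \<Omega>\<^esub> a) (a \<omega>) = \<omega>"
      using BijGroup_inv_apply[OF c[OF aH(1)] \<omega>] .
    then show "inv\<^bsub>BijGroup \<Omega>\<^esub> a \<in> pt_stab \<Omega> H \<omega>"
      using aH H by (simp add: pt_stab_eq subgroup.m_inv_closed)
    fix b assume "b \<in> pt_stab \<Omega> H \<omega>"
    then have bH: "b \<in> H" "b \<omega> = \<omega>" by (auto simp: pt_stab_eq)
    show "a \<otimes>\<^bsub>BijGroup \<Omega>\<^esub> b \<in> pt_stab \<Omega> H \<omega>"
      using aH bH H BijGroup_apply_mult[OF c[OF aH(1)] c[OF bH(1)] \<omega>]
      by (simp add: pt_stab_eq subgroup.m_closed)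
  qed
qed

locale transitive_normal_subgroup =
  fixes \<Omega> :: "'a set" and G M :: "('a \<Rightarrow> 'a) set" and \<omega> :: 'a
  assumes subgroup_G: "subgroup G (BijGroup \<Omega>)"
    and normal_M: "M \<lhd> perm_group \<Omega> G"
    and transitive_M: "transitive_action (perm_group \<Omega> M) \<Omega> (\<lambda>m. m)"
    and point: "\<omega> \<in> \<Omega>"
begin

abbreviation S :: "('a \<Rightarrow> 'a) monoid" where "S \<equiv> BijGroup \<Omega>"
abbreviation H :: "('a \<Rightarrow> 'a) set" where "H \<equiv> pt_stab \<Omega> G \<omega>"

interpretation S: group S by (rule group_BijGroup)

text \<open>The orbit \<omega>^K, which is the block through \<omega> of the partition belonging to
  \<open>K\<close>.\<close>

definition base_block :: "('a \<Rightarrow> 'a) set \<Rightarrow> 'a set" where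
  "base_block K = (\<lambda>h. h \<omega>) ` K"

definition block_partition :: "('a \<Rightarrow> 'a) set \<Rightarrow> 'a set set" where
  "block_partition K = {m ` base_block K | m. m \<in> M}"

lemma decomposition_of_eq: "decomposition_of \<Omega> M \<omega> \<K> = block_partition ` \<K>"
  by (auto simp: decomposition_of_def block_partition_def base_block_def orbit_def image_def)

section \<open>Elements of \<open>G\<close>, of \<open>M\<close> and of the point stabiliser\<close>

lemma subgroup_M_S: "subgroup M S"
  using S.incl_subgroup[OF subgroup_G] normal_imp_subgroup[OF normal_M] by blast

lemma M_subset_G: "M \<subseteq> G"
  using subgroup.subset[OF normal_imp_subgroup[OF normal_M]] by simp

lemma G_carrier: "g \<in> G \<Longrightarrow> g \<in> carrier S"
  using subgroup.subset[OF subgroup_G] by blast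

lemma M_in_carrier: "m \<in> M \<Longrightarrow> m \<in> carrier S"
  using M_subset_G G_carrier by blast

lemma M_closed: "m \<in> M \<Longrightarrow> n \<in> M \<Longrightarrow> m \<otimes>\<^bsub>S\<^esub> n \<in> M"
  and M_inv: "m \<in> M \<Longrightarrow> inv\<^bsub>S\<^esub> m \<in> M"
  and M_one: "\<one>\<^bsub>S\<^esub> \<in> M"
  using subgroup_M_S by (auto simp: subgroup.m_closed subgroup.m_inv_closed subgroup.one_closed)

lemma M_conj: "g \<in> G \<Longrightarrow> m \<in> M \<Longrightarrow> g \<otimes>\<^bsub>S\<^esub> m \<otimes>\<^bsub>S\<^esub> inv\<^bsub>S\<^esub> g \<in> M"
  using normal.inv_op_closed2[OF normal_M, of g m] S.m_inv_consistent[OF subgroup_G] by simp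

lemma H_subset_G: "H \<subseteq> G" by (auto simp: pt_stab_eq)

lemma subgroup_H: "subgroup H S"
  by (rule subgroup_pt_stab[OF subgroup_G point])

lemma H_carrier: "h \<in> H \<Longrightarrow> h \<in> carrier S"
  using H_subset_G G_carrier by blast

lemma exists_M_apply: "x \<in> \<Omega> \<Longrightarrow> \<exists>m\<in>M. m \<omega> = x"
  using transitive_action.unique_orbit[OF transitive_M point] by auto

text \<open>The Frattini argument: some \<open>n\<close> in \<open>M\<close> sends \<omega> to the
  same point as \<open>g\<close>, and the remaining factor \<open>inv n \<otimes> g\<close> fixes
  \<omega>.\<close>

lemma G_factor:
  assumes "g \<in> G"
  obtains n h where "n \<in> M" "h \<in> H" "g = n \<otimes>\<^bsub>S\<^esub> h"
proof -
  obtain n where n: "n \<in> M" "n \<omega> = g \<omega>"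
    using exists_M_apply BijGroup_apply_closed[OF G_carrier[OF assms] point] by blast
  note c = M_in_carrier[OF n(1)] G_carrier[OF assms]
  have "(inv\<^bsub>S\<^esub> n \<otimes>\<^bsub>S\<^esub> g) \<omega> = (inv\<^bsub>S\<^esub> n) (n \<omega>)"
    using c n point by (simp add: BijGroup_apply_mult)
  then have "(inv\<^bsub>S\<^esub> n \<otimes>\<^bsub>S\<^esub> g) \<omega> = \<omega>" using c point by (simp add: BijGroup_inv_apply)
  moreover have "inv\<^bsub>S\<^esub> n \<otimes>\<^bsub>S\<^esub> g \<in> G"
    using n(1) M_subset_G assms subgroup_G by (auto simp: subgroup.m_closed subgroup.m_inv_closed)
  ultimately have "inv\<^bsub>S\<^esub> n \<otimes>\<^bsub>S\<^esub> g \<in> H" by (simp add: pt_stab_eq)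
  moreover have "g = n \<otimes>\<^bsub>S\<^esub> (inv\<^bsub>S\<^esub> n \<otimes>\<^bsub>S\<^esub> g)" using c by (simp add: S.m_assoc[symmetric])
  ultimately show ?thesis using that n(1) by blast
qed

text \<open>Points of a block \<open>(\<omega>\<^sup>K)\<^sup>m\<close> correspond to the elements of a coset of \<open>K\<close>, because
  \<open>K\<close> contains the point stabiliser.\<close>

lemma mem_block_iff:
  assumes K: "subgroup K S" "K \<subseteq> M" "pt_stab \<Omega> M \<omega> \<subseteq> K" and m: "m \<in> M" and n: "n \<in> M"
  shows "n \<omega> \<in> m ` base_block K \<longleftrightarrow> inv\<^bsub>S\<^esub> m \<otimes>\<^bsub>S\<^esub> n \<in> K"
proof
  note c = M_in_carrier[OF m] M_in_carrier[OF n]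
  {
    assume "n \<omega> \<in> m ` base_block K"
    then obtain h where h: "h \<in> K" "n \<omega> = m (h \<omega>)" by (auto simp: base_block_def)
    have hc: "h \<in> carrier S" "h \<in> M" using h K M_in_carrier by auto
    \<comment> \<open>Since \<open>n\<close> and \<open>m \<otimes> h\<close> agree at \<omega>,
      this element fixes \<omega>; it lies in \<open>M\<close>, so it belongs to M_\<omega> and
      therefore to \<open>K\<close>.\<close>
    let ?x = "inv\<^bsub>S\<^esub> h \<otimes>\<^bsub>S\<^esub> (inv\<^bsub>S\<^esub> m \<otimes>\<^bsub>S\<^esub> n)"
    have "n \<omega> = (m \<otimes>\<^bsub>S\<^esub> h) \<omega>" using h(2) c hc point by (simp add: BijGroup_apply_mult)
    then have "(inv\<^bsub>S\<^esub> (m \<otimes>\<^bsub>S\<^esub> h) \<otimes>\<^bsub>S\<^esub> n) \<omega> = (inv\<^bsub>S\<^esub> (m \<otimes>\<^bsub>S\<^esub> h)) ((m \<otimes>\<^bsub>S\<^esub> h) \<omega>)"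
      using BijGroup_apply_mult[of "inv\<^bsub>S\<^esub> (m \<otimes>\<^bsub>S\<^esub> h)" \<Omega> n \<omega>] c hc point by simp
    also have "\<dots> = \<omega>" using c hc point by (intro BijGroup_inv_apply) simp_all
    also have "inv\<^bsub>S\<^esub> (m \<otimes>\<^bsub>S\<^esub> h) \<otimes>\<^bsub>S\<^esub> n = ?x"
      using c hc by (simp add: S.inv_mult_group S.m_assoc)
    finally have "?x \<in> K" using K(3) hc m n M_closed M_inv by (auto simp: pt_stab_eq)
    then have "h \<otimes>\<^bsub>S\<^esub> ?x \<in> K" using subgroup.m_closed[OF K(1) h(1)] by blast
    then show "inv\<^bsub>S\<^esub> m \<otimes>\<^bsub>S\<^esub> n \<in> K" using c hc by (simp add: S.m_assoc[symmetric])
  }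
  assume i: "inv\<^bsub>S\<^esub> m \<otimes>\<^bsub>S\<^esub> n \<in> K"
  have "m ((inv\<^bsub>S\<^esub> m \<otimes>\<^bsub>S\<^esub> n) \<omega>) = (m \<otimes>\<^bsub>S\<^esub> (inv\<^bsub>S\<^esub> m \<otimes>\<^bsub>S\<^esub> n)) \<omega>"
    using c point by (simp add: BijGroup_apply_mult)
  also have "m \<otimes>\<^bsub>S\<^esub> (inv\<^bsub>S\<^esub> m \<otimes>\<^bsub>S\<^esub> n) = n" using c by (simp add: S.m_assoc[symmetric])
  finally have "m ((inv\<^bsub>S\<^esub> m \<otimes>\<^bsub>S\<^esub> n) \<omega>) = n \<omega>" .
  then show "n \<omega> \<in> m ` base_block K" using i unfolding base_block_def image_image
    by (metis (no_types, lifting) image_eqI)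
qed

lemma base_block_subset: "K \<subseteq> M \<Longrightarrow> base_block K \<subseteq> \<Omega>"
  using M_in_carrier BijGroup_apply_closed point by (fastforce simp: base_block_def)

lemma block_subset:
  assumes "K \<subseteq> M" "m \<in> M"
  shows "m ` base_block K \<subseteq> \<Omega>"
  using base_block_subset[OF assms(1)] BijGroup_apply_closed[OF M_in_carrier[OF assms(2)]] by blast

text \<open>By \<open>mem_block_iff\<close> a block depends only on the coset of \<open>K\<close>
  containing its representative, and here \<open>m\<close> and \<open>n\<close> represent the same
  coset.\<close>

lemma block_eq_iff:
  assumes K: "subgroup K S" "K \<subseteq> M" "pt_stab \<Omega> M \<omega> \<subseteq> K" and m: "m \<in> M" and n: "n \<in> M"
    and mn: "inv\<^bsub>S\<^esub> m \<otimes>\<^bsub>S\<^esub> n \<in> K"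
  shows "m ` base_block K = n ` base_block K"
proof (rule Set.set_eqI)
  fix x
  note c = M_in_carrier[OF m] M_in_carrier[OF n]
  have nm: "inv\<^bsub>S\<^esub> n \<otimes>\<^bsub>S\<^esub> m \<in> K"
    using subgroup.m_inv_closed[OF K(1) mn] c by (simp add: S.inv_mult_group)
  show "x \<in> m ` base_block K \<longleftrightarrow> x \<in> n ` base_block K"
  proof (cases "x \<in> \<Omega>")
    case True
    then obtain l where l: "l \<in> M" "x = l \<omega>" using exists_M_apply by blast
    have lc: "l \<in> carrier S" using l M_in_carrier by blast
    have "inv\<^bsub>S\<^esub> a \<otimes>\<^bsub>S\<^esub> l = inv\<^bsub>S\<^esub> a \<otimes>\<^bsub>S\<^esub> b \<otimes>\<^bsub>S\<^esub> (inv\<^bsub>S\<^esub> b \<otimes>\<^bsub>S\<^esub> l)" if "a \<in> carrier S" "b \<in> carrier S" for a b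
    proof -
      have "inv\<^bsub>S\<^esub> a \<otimes>\<^bsub>S\<^esub> b \<otimes>\<^bsub>S\<^esub> (inv\<^bsub>S\<^esub> b \<otimes>\<^bsub>S\<^esub> l) = inv\<^bsub>S\<^esub> a \<otimes>\<^bsub>S\<^esub> (b \<otimes>\<^bsub>S\<^esub> inv\<^bsub>S\<^esub> b) \<otimes>\<^bsub>S\<^esub> l"
        using that lc by (simp only: S.m_assoc S.m_closed S.inv_closed)
      then show ?thesis using that lc by simp
    qed
    then have "inv\<^bsub>S\<^esub> m \<otimes>\<^bsub>S\<^esub> l = inv\<^bsub>S\<^esub> m \<otimes>\<^bsub>S\<^esub> n \<otimes>\<^bsub>S\<^esub> (inv\<^bsub>S\<^esub> n \<otimes>\<^bsub>S\<^esub> l)" "inv\<^bsub>S\<^esub> n \<otimes>\<^bsub>S\<^esub> l = inv\<^bsub>S\<^esub> n \<otimes>\<^bsub>S\<^esub> m \<otimes>\<^bsub>S\<^esub> (inv\<^bsub>S\<^esub> m \<otimes>\<^bsub>S\<^esub> l)"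
      using c by blast+
    then have "inv\<^bsub>S\<^esub> m \<otimes>\<^bsub>S\<^esub> l \<in> K \<longleftrightarrow> inv\<^bsub>S\<^esub> n \<otimes>\<^bsub>S\<^esub> l \<in> K"
      using mn nm K(1) by (metis subgroup.m_closed)
    then show ?thesis using mem_block_iff[OF K m l(1)] mem_block_iff[OF K n l(1)] l by simp
  next
    case False
    then show ?thesis using block_subset[OF K(2) m] block_subset[OF K(2) n] by blast
  qed
qed

text \<open>Blocks behave like cosets of \<open>K\<close> in \<open>M\<close>: transitivity makes
  them cover \<Omega>, and a common point forces two representatives into one coset.\<close>

lemma partition_on_block_partition:
  assumes K: "subgroup K S" "K \<subseteq> M" "pt_stab \<Omega> M \<omega> \<subseteq> K"
  shows "partition_on \<Omega> (block_partition K)"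
proof (rule partition_onI)
  have own: "m \<omega> \<in> m ` base_block K" if "m \<in> M" for m
    using mem_block_iff[OF K that that] subgroup.one_closed[OF K(1)] M_in_carrier[OF that] by simp
  show "\<Union>(block_partition K) = \<Omega>"
  proof
    show "\<Union>(block_partition K) \<subseteq> \<Omega>"
      using block_subset[OF K(2)] by (auto simp: block_partition_def)
    show "\<Omega> \<subseteq> \<Union>(block_partition K)"
    proof
      fix x assume "x \<in> \<Omega>"
      then obtain m where "m \<in> M" "m \<omega> = x" using exists_M_apply by blast
      then have "x \<in> m ` base_block K" "m ` base_block K \<in> block_partition K"
        using own by (auto simp: block_partition_def)
      then show "x \<in> \<Union>(block_partition K)" by blast
    qed
  qed
  show "{} \<notin> block_partition K"
    using own by (auto simp: block_partition_def)
  fix p p' assume p: "p \<in> block_partition K" "p' \<in> block_partition K" "p \<noteq> p'"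
  then obtain m n where m: "m \<in> M" "p = m ` base_block K" and n: "n \<in> M" "p' = n ` base_block K"
    by (auto simp: block_partition_def)
  show "disjnt p p'"
  proof (rule ccontr)
    assume "\<not> disjnt p p'"
    then obtain x where x: "x \<in> p" "x \<in> p'" by (auto simp: disjnt_def)
    then have "x \<in> \<Omega>" using block_subset[OF K(2) m(1)] m by blast
    then obtain l where l: "l \<in> M" "x = l \<omega>" using exists_M_apply by blast
    then have "inv\<^bsub>S\<^esub> m \<otimes>\<^bsub>S\<^esub> l \<in> K" "inv\<^bsub>S\<^esub> n \<otimes>\<^bsub>S\<^esub> l \<in> K"
      using mem_block_iff[OF K] m n x by auto
    then show False using p block_eq_iff[OF K] m n l by metis
  qed
qed

text \<open>The blocks \<open>(\<omega>\<^sup>K)\<^sup>m\<close> for \<open>K\<close> in a Cartesian system meet because the factorisations allow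
  solving the coset conditions one at a time.\<close>

lemma cartesian_system_cosets_meet:
  assumes cs: "cartesian_system \<Omega> M \<omega> \<K>" and a: "\<And>K. K \<in> \<K> \<Longrightarrow> a K \<in> M"
    and fin: "finite \<F>" and sub: "\<F> \<subseteq> \<K>"
  shows "\<exists>n\<in>M. \<forall>K\<in>\<F>. inv\<^bsub>S\<^esub> (a K) \<otimes>\<^bsub>S\<^esub> n \<in> K"
  using fin sub
proof (induction \<F> rule: finite_induct)
  case empty
  then show ?case using M_one by blast
next
  case (insert K \<F>)
  then obtain n where n: "n \<in> M" "\<And>L. L \<in> \<F> \<Longrightarrow> inv\<^bsub>S\<^esub> (a L) \<otimes>\<^bsub>S\<^esub> n \<in> L" by auto
  have K: "K \<in> \<K>" using insert by simp
  then have fact: "K <#>\<^bsub>S\<^esub> (M \<inter> \<Inter>(\<K> - {K})) = M"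
    using cs by (simp add: cartesian_system_def)
  have subS: "subgroup L S" if "L \<in> \<K>" for L
    using cs that S.incl_subgroup[OF subgroup_M_S] by (auto simp: cartesian_system_def)
  have aM: "a K \<in> M" using a K by blast
  have "inv\<^bsub>S\<^esub> (a K) \<otimes>\<^bsub>S\<^esub> n \<in> M" using n(1) aM M_closed M_inv by blast
  then obtain h c where h: "h \<in> K" and "c \<in> M \<inter> \<Inter>(\<K> - {K})"
    and eq: "inv\<^bsub>S\<^esub> (a K) \<otimes>\<^bsub>S\<^esub> n = h \<otimes>\<^bsub>S\<^esub> c"
    using set_multE fact by metis
  then have c: "c \<in> M" "\<And>L. L \<in> \<K> \<Longrightarrow> L \<noteq> K \<Longrightarrow> c \<in> L" by auto
  have hc: "h \<in> carrier S" using h subS[OF K] subgroup.subset by blast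
  note cc = M_in_carrier[OF c(1)] M_in_carrier[OF n(1)] M_in_carrier[OF aM]
  \<comment> \<open>Dividing by \<open>c\<close> on the right keeps the conditions already solved,
    because \<open>c\<close> lies in every other member of the system; for \<open>K\<close> itself
    it leaves exactly \<open>h\<close>, which is in \<open>K\<close>.\<close>
  let ?n = "n \<otimes>\<^bsub>S\<^esub> inv\<^bsub>S\<^esub> c"
  have "inv\<^bsub>S\<^esub> (a K) \<otimes>\<^bsub>S\<^esub> ?n = inv\<^bsub>S\<^esub> (a K) \<otimes>\<^bsub>S\<^esub> n \<otimes>\<^bsub>S\<^esub> inv\<^bsub>S\<^esub> c"
    using cc by (simp add: S.m_assoc)
  also have "\<dots> = h" unfolding eq using cc hc by (simp add: S.m_assoc)
  finally have 1: "inv\<^bsub>S\<^esub> (a K) \<otimes>\<^bsub>S\<^esub> ?n \<in> K" using h by simp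
  have 2: "inv\<^bsub>S\<^esub> (a L) \<otimes>\<^bsub>S\<^esub> ?n \<in> L" if L: "L \<in> \<F>" for L
  proof -
    have L': "L \<in> \<K>" "L \<noteq> K" using L insert by auto
    have "inv\<^bsub>S\<^esub> (a L) \<otimes>\<^bsub>S\<^esub> ?n = inv\<^bsub>S\<^esub> (a L) \<otimes>\<^bsub>S\<^esub> n \<otimes>\<^bsub>S\<^esub> inv\<^bsub>S\<^esub> c"
      using cc M_in_carrier[OF a[OF L'(1)]] by (simp add: S.m_assoc)
    then show ?thesis
      using n(2)[OF L] c(2)[OF L'] subS[OF L'(1)]
      by (simp add: subgroup.m_closed subgroup.m_inv_closed)
  qed
  show ?case using 1 2 n(1) c(1) M_closed M_inv by (intro bexI[of _ ?n]) auto
qed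

section \<open>The decomposition belonging to a Cartesian system\<close>

context
  fixes \<K> assumes cs: "cartesian_system \<Omega> M \<omega> \<K>"
begin

lemma system_subgroup:
  assumes "K \<in> \<K>"
  shows "subgroup K S" "K \<subseteq> M" "pt_stab \<Omega> M \<omega> \<subseteq> K" "K \<noteq> M"
proof -
  have K: "subgroup K (perm_group \<Omega> M)" using cs assms unfolding cartesian_system_def by blast
  then show "subgroup K S" by (rule S.incl_subgroup[OF subgroup_M_S])
  show "K \<subseteq> M" using subgroup.subset[OF K] by simp
  have "\<Inter>\<K> = pt_stab \<Omega> M \<omega>" using cs unfolding cartesian_system_def by blast
  then show "pt_stab \<Omega> M \<omega> \<subseteq> K" using Inter_lower[OF assms] by simp
  show "K \<noteq> M" using cs assms unfolding cartesian_system_def by blast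
qed

lemma base_block_in_partition: "K \<in> \<K> \<Longrightarrow> base_block K \<in> block_partition K"
proof -
  assume "K \<in> \<K>"
  then have "\<one>\<^bsub>S\<^esub> ` base_block K = base_block K"
    using BijGroup_image_one[OF base_block_subset] system_subgroup(2) by blast
  then show ?thesis unfolding block_partition_def using M_one by blast
qed

lemma mem_base_block_iff:
  assumes "K \<in> \<K>" "n \<in> M"
  shows "n \<omega> \<in> base_block K \<longleftrightarrow> n \<in> K"
proof -
  have "\<one>\<^bsub>S\<^esub> ` base_block K = base_block K"
    using BijGroup_image_one[OF base_block_subset] system_subgroup(2) assms(1) by blast
  then show ?thesis
    using mem_block_iff[OF system_subgroup(1-3)[OF assms(1)] M_one assms(2)]
      M_in_carrier[OF assms(2)] by simp
qed

text \<open>A choice of one block from each partition is a choice of one coset of each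
  \<open>K\<close>. The cosets have a common element \<open>n\<close>, so all chosen blocks contain
  the point \<open>n \<omega>\<close>; any other common point differs from it by an element of the
  intersection M_\<omega>, so it is the same point.\<close>

lemma cartesian_decomposition_of_system: "cartesian_decomposition \<Omega> (decomposition_of \<Omega> M \<omega> \<K>)"
  unfolding cartesian_decomposition_def decomposition_of_eq
proof (intro conjI ballI allI impI)
  show "finite (block_partition ` \<K>)" "block_partition ` \<K> \<noteq> {}"
    using cs by (auto simp: cartesian_system_def)
  fix P assume "P \<in> block_partition ` \<K>"
  then obtain K where K: "K \<in> \<K>" "P = block_partition K" by blast
  show "partition_on \<Omega> P"
    using partition_on_block_partition system_subgroup K by blast
  show "P \<noteq> {\<Omega>}"
  proof
    assume "P = {\<Omega>}"
    \<comment> \<open>If \<Omega> were the only block, every element of \<open>M\<close> would send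
      \<omega> into the base block and so lie in \<open>K\<close>, contrary to properness.\<close>
    then have "base_block K = \<Omega>" using base_block_in_partition K by blast
    then have "m \<in> K" if "m \<in> M" for m
      using mem_base_block_iff[OF K(1) that] BijGroup_apply_closed[OF M_in_carrier[OF that] point]
      by simp
    then show False using system_subgroup(2,4)[OF K(1)] by blast
  qed
next
  fix \<gamma> assume \<gamma>: "\<forall>P\<in>block_partition ` \<K>. \<gamma> P \<in> P"
  have "\<exists>m\<in>M. \<gamma> (block_partition K) = m ` base_block K" if "K \<in> \<K>" for K
  proof -
    have "\<gamma> (block_partition K) \<in> block_partition K" using \<gamma> that by blast
    then show ?thesis by (subst (asm) (2) block_partition_def) blast
  qed
  then obtain a where a: "\<And>K. K \<in> \<K> \<Longrightarrow> a K \<in> M"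
      "\<And>K. K \<in> \<K> \<Longrightarrow> \<gamma> (block_partition K) = a K ` base_block K"
    by metis
  have fin: "finite \<K>" and ne: "\<K> \<noteq> {}" and Int: "\<Inter>\<K> = pt_stab \<Omega> M \<omega>"
    using cs by (auto simp: cartesian_system_def)
  obtain n where n: "n \<in> M" "\<And>K. K \<in> \<K> \<Longrightarrow> inv\<^bsub>S\<^esub> (a K) \<otimes>\<^bsub>S\<^esub> n \<in> K"
    using cartesian_system_cosets_meet[OF cs, of a \<K>] a(1) fin by blast
  have block: "\<gamma> (block_partition K) = n ` base_block K" if "K \<in> \<K>" for K
    using a n that block_eq_iff[OF system_subgroup(1-3)[OF that]] by simp
  have "(\<Inter>P\<in>block_partition ` \<K>. \<gamma> P) = (\<Inter>K\<in>\<K>. n ` base_block K)"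
    using block by auto
  also have "\<dots> = {n \<omega>}"
  proof
    show "{n \<omega>} \<subseteq> (\<Inter>K\<in>\<K>. n ` base_block K)"
      using mem_block_iff[OF system_subgroup(1-3) n(1) n(1)] subgroup.one_closed
        system_subgroup(1) M_in_carrier[OF n(1)] by auto
    show "(\<Inter>K\<in>\<K>. n ` base_block K) \<subseteq> {n \<omega>}"
    proof
      fix x assume x: "x \<in> (\<Inter>K\<in>\<K>. n ` base_block K)"
      obtain K where "K \<in> \<K>" using ne by blast
      then have "x \<in> \<Omega>" using block_subset[OF system_subgroup(2) n(1)] x by blast
      then obtain l where l: "l \<in> M" "x = l \<omega>" using exists_M_apply by blast
      then have "inv\<^bsub>S\<^esub> n \<otimes>\<^bsub>S\<^esub> l \<in> \<Inter>\<K>"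
        using mem_block_iff[OF system_subgroup(1-3) n(1)] x by blast
      then have "(inv\<^bsub>S\<^esub> n \<otimes>\<^bsub>S\<^esub> l) \<omega> = \<omega>" using Int by (simp add: pt_stab_eq)
      then have "n ((inv\<^bsub>S\<^esub> n \<otimes>\<^bsub>S\<^esub> l) \<omega>) = n \<omega>" by simp
      moreover have "n ((inv\<^bsub>S\<^esub> n \<otimes>\<^bsub>S\<^esub> l) \<omega>) = (n \<otimes>\<^bsub>S\<^esub> (inv\<^bsub>S\<^esub> n \<otimes>\<^bsub>S\<^esub> l)) \<omega>"
        using M_in_carrier n l point by (simp add: BijGroup_apply_mult)
      moreover have "n \<otimes>\<^bsub>S\<^esub> (inv\<^bsub>S\<^esub> n \<otimes>\<^bsub>S\<^esub> l) = l"
        using M_in_carrier n l by (simp add: S.m_assoc[symmetric])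
      ultimately show "x \<in> {n \<omega>}" using l by simp
    qed
  qed
  finally show "card (\<Inter>P\<in>block_partition ` \<K>. \<gamma> P) = 1" by simp
qed

text \<open>An element stabilising the block keeps \<omega> inside it and so lies in
  \<open>K\<close>; conversely elements of \<open>K\<close> represent the same coset as the identity
  and hence the same block.\<close>

lemma set_stab_base_block:
  assumes K: "K \<in> \<K>"
  shows "set_stab \<Omega> M (base_block K) = K"
proof
  note sub = system_subgroup[OF K]
  have \<omega>: "\<omega> \<in> base_block K"
    using mem_base_block_iff[OF K M_one] subgroup.one_closed[OF sub(1)] BijGroup_apply_one[OF point]
    by simp
  show "set_stab \<Omega> M (base_block K) \<subseteq> K"
    using mem_base_block_iff[OF K] \<omega> by (auto simp: set_stab_eq)
  have one: "\<one>\<^bsub>S\<^esub> ` base_block K = base_block K"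
    using BijGroup_image_one[OF base_block_subset] sub(2) by blast
  show "K \<subseteq> set_stab \<Omega> M (base_block K)"
  proof
    fix h assume h: "h \<in> K"
    then have hM: "h \<in> M" using sub by blast
    have "h ` base_block K = \<one>\<^bsub>S\<^esub> ` base_block K"
      using h M_in_carrier[OF hM] subgroup.m_inv_closed[OF sub(1)]
      by (intro block_eq_iff[OF sub(1-3) hM M_one]) simp
    then show "h \<in> set_stab \<Omega> M (base_block K)" using hM one by (simp add: set_stab_eq)
  qed
qed

text \<open>In each partition the block through \<omega> is unique, and its stabiliser is the
  original subgroup. This allows \<open>F_set\<close>, \<open>end_at\<close> and
  \<open>digraph_of\<close>, which refer to the decomposition, to be evaluated on the
  subgroups.\<close>

lemma system_of_decomposition_of: "system_of \<Omega> M \<omega> (decomposition_of \<Omega> M \<omega> \<K>) = \<K>"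
proof -
  have \<omega>: "\<omega> \<in> base_block K" if "K \<in> \<K>" for K
    using mem_base_block_iff[OF that M_one] subgroup.one_closed[OF system_subgroup(1)[OF that]]
      BijGroup_apply_one[OF point] by simp
  have unique: "\<gamma> = base_block K" if "K \<in> \<K>" "\<gamma> \<in> block_partition K" "\<omega> \<in> \<gamma>" for K \<gamma>
    using partition_on_block_partition[OF system_subgroup(1-3)[OF that(1)]]
      base_block_in_partition[OF that(1)] \<omega>[OF that(1)] that(2,3)
    by (metis (no_types) IntI disjointD empty_iff partition_onD2)
  show ?thesis
  proof
    show "system_of \<Omega> M \<omega> (decomposition_of \<Omega> M \<omega> \<K>) \<subseteq> \<K>"
    proof
      fix L assume "L \<in> system_of \<Omega> M \<omega> (decomposition_of \<Omega> M \<omega> \<K>)"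
      then obtain K \<gamma> where "K \<in> \<K>" "\<gamma> \<in> block_partition K" "\<omega> \<in> \<gamma>" "L = set_stab \<Omega> M \<gamma>"
        by (auto simp: system_of_def decomposition_of_eq)
      then show "L \<in> \<K>" using unique set_stab_base_block by metis
    qed
    show "\<K> \<subseteq> system_of \<Omega> M \<omega> (decomposition_of \<Omega> M \<omega> \<K>)"
    proof
      fix K assume K: "K \<in> \<K>"
      have "\<exists>P \<gamma>. K = set_stab \<Omega> M \<gamma> \<and> P \<in> block_partition ` \<K> \<and> \<gamma> \<in> P \<and> \<omega> \<in> \<gamma>"
        using set_stab_base_block[OF K] base_block_in_partition[OF K] \<omega>[OF K] K by blast
      then show "K \<in> system_of \<Omega> M \<omega> (decomposition_of \<Omega> M \<omega> \<K>)"
        by (simp add: system_of_def decomposition_of_eq)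
    qed
  qed
qed

text \<open>Since \<open>h\<close> fixes \<omega>, it carries the orbit of \<open>K\<close> to the
  orbit of its conjugate, and it normalises \<open>M\<close>; the factor \<open>n\<close> only
  permutes the translates. By \<open>G_factor\<close> every element of \<open>G\<close> has the form
  treated here.\<close>

lemma partition_image_block_partition:
  assumes K: "K \<in> \<K>" and n: "n \<in> M" and h: "h \<in> H"
  shows "partition_image (n \<otimes>\<^bsub>S\<^esub> h) (block_partition K) = block_partition (conj_set S K h)"
proof -
  let ?g = "n \<otimes>\<^bsub>S\<^esub> h"
  note sub = system_subgroup[OF K]
  have hG: "h \<in> G" and h\<omega>: "h \<omega> = \<omega>" using h by (auto simp: pt_stab_eq)
  note c = M_in_carrier[OF n] G_carrier[OF hG]
  have ih: "inv\<^bsub>S\<^esub> h \<in> H" using subgroup.m_inv_closed[OF subgroup_H h] .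
  then have ih\<omega>: "(inv\<^bsub>S\<^esub> h) \<omega> = \<omega>" by (simp add: pt_stab_eq)
  have img: "?g ` m ` base_block K
      = (n \<otimes>\<^bsub>S\<^esub> (h \<otimes>\<^bsub>S\<^esub> m \<otimes>\<^bsub>S\<^esub> inv\<^bsub>S\<^esub> h)) ` base_block (conj_set S K h)" if m: "m \<in> M" for m
  proof -
    have "?g (m (x \<omega>)) = (n \<otimes>\<^bsub>S\<^esub> (h \<otimes>\<^bsub>S\<^esub> m \<otimes>\<^bsub>S\<^esub> inv\<^bsub>S\<^esub> h)) ((h \<otimes>\<^bsub>S\<^esub> x \<otimes>\<^bsub>S\<^esub> inv\<^bsub>S\<^esub> h) \<omega>)"
      if x: "x \<in> K" for x
    proof -
      have xc: "x \<in> carrier S" "m \<in> carrier S" using x m sub M_in_carrier by auto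
      have "(n \<otimes>\<^bsub>S\<^esub> (h \<otimes>\<^bsub>S\<^esub> m \<otimes>\<^bsub>S\<^esub> inv\<^bsub>S\<^esub> h)) ((h \<otimes>\<^bsub>S\<^esub> x \<otimes>\<^bsub>S\<^esub> inv\<^bsub>S\<^esub> h) \<omega>)
        = (n \<otimes>\<^bsub>S\<^esub> (h \<otimes>\<^bsub>S\<^esub> m \<otimes>\<^bsub>S\<^esub> inv\<^bsub>S\<^esub> h) \<otimes>\<^bsub>S\<^esub> (h \<otimes>\<^bsub>S\<^esub> x \<otimes>\<^bsub>S\<^esub> inv\<^bsub>S\<^esub> h)) \<omega>"
        using c xc point by (simp add: BijGroup_apply_mult)
      also have "n \<otimes>\<^bsub>S\<^esub> (h \<otimes>\<^bsub>S\<^esub> m \<otimes>\<^bsub>S\<^esub> inv\<^bsub>S\<^esub> h) \<otimes>\<^bsub>S\<^esub> (h \<otimes>\<^bsub>S\<^esub> x \<otimes>\<^bsub>S\<^esub> inv\<^bsub>S\<^esub> h)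
        = n \<otimes>\<^bsub>S\<^esub> h \<otimes>\<^bsub>S\<^esub> m \<otimes>\<^bsub>S\<^esub> (inv\<^bsub>S\<^esub> h \<otimes>\<^bsub>S\<^esub> h) \<otimes>\<^bsub>S\<^esub> x \<otimes>\<^bsub>S\<^esub> inv\<^bsub>S\<^esub> h"
        using c xc by (simp only: S.m_assoc S.m_closed S.inv_closed)
      also have "\<dots> = n \<otimes>\<^bsub>S\<^esub> h \<otimes>\<^bsub>S\<^esub> m \<otimes>\<^bsub>S\<^esub> x \<otimes>\<^bsub>S\<^esub> inv\<^bsub>S\<^esub> h" using c xc by simp
      also have "\<dots> \<omega> = ?g (m (x \<omega>))"
        using c xc point ih\<omega> by (simp add: BijGroup_apply_mult BijGroup_apply_closed)
      finally show ?thesis by simp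
    qed
    then show ?thesis by (force simp: base_block_def S.conj_set_eq_image image_image)
  qed
  show ?thesis
  proof
    show "partition_image ?g (block_partition K) \<subseteq> block_partition (conj_set S K h)"
    proof
      fix X assume "X \<in> partition_image ?g (block_partition K)"
      then obtain m where "m \<in> M" "X = ?g ` m ` base_block K"
        by (auto simp: partition_image_def block_partition_def)
      then show "X \<in> block_partition (conj_set S K h)"
        using img M_closed[OF n M_conj[OF hG]] unfolding block_partition_def by blast
    qed
    show "block_partition (conj_set S K h) \<subseteq> partition_image ?g (block_partition K)"
    proof
      fix X assume "X \<in> block_partition (conj_set S K h)"
      then obtain m' where m': "m' \<in> M" "X = m' ` base_block (conj_set S K h)"
        by (auto simp: block_partition_def)
      \<comment> \<open>The solution of
        \<open>n \<otimes> (h \<otimes> m \<otimes> inv h) = m'\<close>; normality keeps it inside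
        \<open>M\<close>.\<close>
      define m where "m = inv\<^bsub>S\<^esub> h \<otimes>\<^bsub>S\<^esub> (inv\<^bsub>S\<^esub> n \<otimes>\<^bsub>S\<^esub> m') \<otimes>\<^bsub>S\<^esub> h"
      have mM: "m \<in> M"
        using M_conj[of "inv\<^bsub>S\<^esub> h" "inv\<^bsub>S\<^esub> n \<otimes>\<^bsub>S\<^esub> m'"] ih H_subset_G M_closed M_inv n m'(1) c
        by (auto simp: m_def)
      have m'c: "m' \<in> carrier S" using m' M_in_carrier by blast
      have "h \<otimes>\<^bsub>S\<^esub> m \<otimes>\<^bsub>S\<^esub> inv\<^bsub>S\<^esub> h = inv\<^bsub>S\<^esub> n \<otimes>\<^bsub>S\<^esub> m'"
      proof -
        have "h \<otimes>\<^bsub>S\<^esub> m \<otimes>\<^bsub>S\<^esub> inv\<^bsub>S\<^esub> h = (h \<otimes>\<^bsub>S\<^esub> inv\<^bsub>S\<^esub> h) \<otimes>\<^bsub>S\<^esub> (inv\<^bsub>S\<^esub> n \<otimes>\<^bsub>S\<^esub> m') \<otimes>\<^bsub>S\<^esub> (h \<otimes>\<^bsub>S\<^esub> inv\<^bsub>S\<^esub> h)"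
          unfolding m_def using c m'c by (simp only: S.m_assoc S.m_closed S.inv_closed)
        then show ?thesis using c m'c by simp
      qed
      then have "n \<otimes>\<^bsub>S\<^esub> (h \<otimes>\<^bsub>S\<^esub> m \<otimes>\<^bsub>S\<^esub> inv\<^bsub>S\<^esub> h) = m'"
        using c m'c by (simp add: S.m_assoc[symmetric])
      then have "X = ?g ` m ` base_block K" using img[OF mM] m' by simp
      then show "X \<in> partition_image ?g (block_partition K)"
        using mM by (auto simp: partition_image_def block_partition_def)
    qed
  qed
qed

text \<open>Only the component in \<open>H\<close> of an element of \<open>G\<close> affects a
  partition, so invariance and transitivity pass over from the conjugation action on the
  system.\<close>

lemma decomposition_of_in_CD_tr:
  assumes inv: "\<And>K h. K \<in> \<K> \<Longrightarrow> h \<in> H \<Longrightarrow> conj_set S K h \<in> \<K>"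
    and trans: "\<And>K L. K \<in> \<K> \<Longrightarrow> L \<in> \<K> \<Longrightarrow> \<exists>h\<in>H. conj_set S K h = L"
  shows "decomposition_of \<Omega> M \<omega> \<K> \<in> CD_tr \<Omega> G"
  unfolding CD_tr_def mem_Collect_eq
proof (intro conjI ballI)
  show "cartesian_decomposition \<Omega> (decomposition_of \<Omega> M \<omega> \<K>)"
    by (rule cartesian_decomposition_of_system)
  fix P assume "P \<in> decomposition_of \<Omega> M \<omega> \<K>"
  then obtain K where K: "K \<in> \<K>" "P = block_partition K" by (auto simp: decomposition_of_eq)
  show "partition_image g P \<in> decomposition_of \<Omega> M \<omega> \<K>" if "g \<in> G" for g
    using G_factor[OF that] partition_image_block_partition[OF K(1)] inv[OF K(1)] K(2)
    by (metis decomposition_of_eq imageI)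
  fix Q assume "Q \<in> decomposition_of \<Omega> M \<omega> \<K>"
  then obtain L where L: "L \<in> \<K>" "Q = block_partition L" by (auto simp: decomposition_of_eq)
  then obtain h where h: "h \<in> H" "conj_set S K h = L" using trans K by blast
  then have "partition_image h P = Q"
    using partition_image_block_partition[OF K(1) M_one h(1)] K L H_carrier by simp
  then show "\<exists>g\<in>G. partition_image g P = Q" using h H_subset_G by blast
qed

end

end

section \<open>The groups attached to the vertices\<close>

locale digraph_construction = transitive_normal_subgroup \<Omega> G M \<omega>
  for \<Omega> :: "'a set" and G M :: "('a \<Rightarrow> 'a) set" and \<omega> :: 'a +
  fixes T :: "nat \<Rightarrow> ('a \<Rightarrow> 'a) set" and k :: nat and A B :: "('a \<Rightarrow> 'a) set"
    and \<Gamma> :: "('v, ('a \<Rightarrow> 'a) set) pre_digraph" and \<phi> :: "('a \<Rightarrow> 'a) \<Rightarrow> 'v \<Rightarrow> 'v"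
  assumes finite_G: "finite G"
    and M_nontrivial: "M \<noteq> {\<one>\<^bsub>BijGroup \<Omega>\<^esub>}"
    and factors: "simple_direct_factors (BijGroup \<Omega>) M T k"
    and stab_eq: "pt_stab \<Omega> M \<omega> = full_prod (BijGroup \<Omega>) (\<lambda>i. proj (BijGroup \<Omega>) T k i ` pt_stab \<Omega> M \<omega>) k"
    and subgroup_A: "subgroup A (perm_group \<Omega> (T 1))"
    and subgroup_B: "subgroup B (perm_group \<Omega> (T 1))"
    and A_proper: "A \<noteq> T 1" and B_proper: "B \<noteq> T 1"
    and A_B_nonconj: "\<not> conjugate_under (BijGroup \<Omega>) (pt_stab \<Omega> G \<omega>) A B"
    and A_B_prod: "A <#>\<^bsub>BijGroup \<Omega>\<^esub> B = T 1"
    and A_B_Int: "A \<inter> B = proj (BijGroup \<Omega>) T k 1 ` pt_stab \<Omega> M \<omega>"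
    and normalizer_A: "pt_stab \<Omega> G \<omega> \<inter> normalizer (BijGroup \<Omega>) (T 1) = pt_stab \<Omega> G \<omega> \<inter> normalizer (BijGroup \<Omega>) A"
    and normalizer_B: "pt_stab \<Omega> G \<omega> \<inter> normalizer (BijGroup \<Omega>) A = pt_stab \<Omega> G \<omega> \<inter> normalizer (BijGroup \<Omega>) B"
    and digraph: "gen_digraph \<Gamma>" and arcs_eq: "arcs \<Gamma> = T ` {1..k}"
    and trans_verts: "transitive_action (perm_group \<Omega> (pt_stab \<Omega> G \<omega>)) (verts \<Gamma>) \<phi>"
    and trans_arcs: "transitive_action (perm_group \<Omega> (pt_stab \<Omega> G \<omega>)) (arcs \<Gamma>)
      (\<lambda>h. \<lambda>X\<in>arcs \<Gamma>. conj_set (BijGroup \<Omega>) X h)"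
    and auts: "\<forall>h\<in>pt_stab \<Omega> G \<omega>. (\<phi> h, \<lambda>X\<in>arcs \<Gamma>. conj_set (BijGroup \<Omega>) X h) \<in> digraph_auts \<Gamma>"
begin

sublocale D: direct_decomposition S M T k
  using subgroup_M_S factors group_BijGroup
  by (simp add: direct_decomposition_def direct_decomposition_axioms_def simple_direct_factors_def)

abbreviation \<sigma> :: "nat \<Rightarrow> ('a \<Rightarrow> 'a) \<Rightarrow> ('a \<Rightarrow> 'a)" where "\<sigma> \<equiv> proj S T k"

abbreviation conj :: "('a \<Rightarrow> 'a) set \<Rightarrow> ('a \<Rightarrow> 'a) \<Rightarrow> ('a \<Rightarrow> 'a) set" where
  "conj \<equiv> conj_set S"

text \<open>For \<open>k = 0\<close> the empty product would make \<open>M\<close> trivial, so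
  \<open>T 1\<close> is a genuine factor.\<close>

lemma one_index: "1 \<in> {1..k}"
proof (rule ccontr)
  assume "1 \<notin> {1..k}"
  then have "k = 0" by simp
  then show False using D.M_eq M_nontrivial by simp
qed

lemma T_subset_carrier: "i \<in> {1..k} \<Longrightarrow> T i \<subseteq> carrier S"
  using D.T_carrier by blast

lemma T_nontrivial:
  assumes "i \<in> {1..k}"
  shows "T i \<noteq> {\<one>\<^bsub>S\<^esub>}"
proof -
  have "simple_group (S\<lparr>carrier := T i\<rparr>)" using factors assms by (simp add: simple_direct_factors_def)
  from simple_group.simple_not_triv[OF this] show ?thesis by simp
qed

text \<open>Two equal factors with different indices would intersect trivially, but simple groups
  are nontrivial. Hence an arc determines its index, on which the definition of
  \<open>digraph_of\<close> relies.\<close>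

lemma inj_on_T: "inj_on T {1..k}"
proof (rule inj_onI, rule ccontr)
  fix i j assume ij: "i \<in> {1..k}" "j \<in> {1..k}" "T i = T j" "i \<noteq> j"
  then show False using D.T_Int[OF ij(1,2,4)] T_nontrivial[OF ij(1)] by simp
qed

lemma finite_T: "i \<in> {1..k} \<Longrightarrow> finite (T i)"
  using finite_subset[OF _ finite_G] D.T_subset_M M_subset_G by blast

section \<open>Action of the point stabiliser on the simple factors\<close>

lemma arc_conj:
  assumes h: "h \<in> H" and i: "i \<in> {1..k}"
  obtains j where "j \<in> {1..k}" "conj (T i) h = T j"
proof -
  interpret E: transitive_action "perm_group \<Omega> H" "arcs \<Gamma>" "\<lambda>h. \<lambda>X\<in>arcs \<Gamma>. conj X h"
    by (rule trans_arcs)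
  have "(\<lambda>X\<in>arcs \<Gamma>. conj X h) ` arcs \<Gamma> = arcs \<Gamma>" using E.surj_prop h by simp
  moreover have Ti: "T i \<in> arcs \<Gamma>" using arcs_eq i by blast
  ultimately have "(\<lambda>X\<in>arcs \<Gamma>. conj X h) (T i) \<in> arcs \<Gamma>" by (metis imageI)
  then have "conj (T i) h \<in> T ` {1..k}" using Ti unfolding restrict_apply arcs_eq by presburger
  then show ?thesis using that by blast
qed

lemma arc_conj_pre:
  assumes h: "h \<in> H" and j: "j \<in> {1..k}"
  obtains i where "i \<in> {1..k}" "conj (T i) h = T j"
proof -
  have "inv\<^bsub>S\<^esub> h \<in> H" using subgroup.m_inv_closed[OF subgroup_H h] .
  then obtain i where i: "i \<in> {1..k}" "conj (T j) (inv\<^bsub>S\<^esub> h) = T i" using arc_conj j by blast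
  then have "conj (T i) h = T j"
    using D.conj_set_inv(2)[OF H_carrier[OF h] T_subset_carrier[OF j]] by simp
  then show ?thesis using that i by blast
qed

text \<open>Conjugation by \<open>h\<close> permutes the factors injectively, so no factor other
  than \<open>T i\<close> is sent to \<open>T j\<close>; this is the permutation hypothesis of
  \<open>proj_conj\<close>.\<close>

lemma proj_equivariant:
  assumes h: "h \<in> H" and ij: "i \<in> {1..k}" "j \<in> {1..k}" "conj (T i) h = T j" and m: "m \<in> M"
  shows "\<sigma> j (h \<otimes>\<^bsub>S\<^esub> m \<otimes>\<^bsub>S\<^esub> inv\<^bsub>S\<^esub> h) = h \<otimes>\<^bsub>S\<^esub> \<sigma> i m \<otimes>\<^bsub>S\<^esub> inv\<^bsub>S\<^esub> h"
proof (rule D.proj_conj[OF H_carrier[OF h] ij _ m])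
  fix l assume l: "l \<in> {1..k}" "l \<noteq> i"
  obtain l' where l': "l' \<in> {1..k}" "conj (T l) h = T l'" using arc_conj h l(1) .
  have "l' \<noteq> j"
  proof
    assume "l' = j"
    then have "conj (T l) h = conj (T i) h" using l' ij by simp
    then have "T l = T i"
      using D.conj_set_inv(1)[OF H_carrier[OF h]] T_subset_carrier l(1) ij(1) by metis
    then show False using inj_on_T l ij(1) by (auto dest: inj_onD)
  qed
  then show "\<exists>l'\<in>{1..k}. l' \<noteq> j \<and> conj (T l) h = T l'" using l' by blast
qed

lemma exists_transporter:
  assumes i: "i \<in> {1..k}"
  shows "\<exists>h\<in>H. conj (T 1) h = T i"
proof -
  interpret E: transitive_action "perm_group \<Omega> H" "arcs \<Gamma>" "\<lambda>h. \<lambda>X\<in>arcs \<Gamma>. conj X h"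
    by (rule trans_arcs)
  have "T 1 \<in> arcs \<Gamma>" "T i \<in> arcs \<Gamma>" using arcs_eq i one_index by blast+
  then show ?thesis using E.unique_orbit[of "T 1" "T i"] by auto
qed

lemma exists_transporters: "\<exists>g. transporters \<Omega> G T k \<omega> g"
  using exists_transporter unfolding transporters_def by metis

lemma A_subset: "A \<subseteq> T 1" and B_subset: "B \<subseteq> T 1"
  using subgroup.subset[OF subgroup_A] subgroup.subset[OF subgroup_B] by simp_all

lemma A_carrier: "A \<subseteq> carrier S" and B_carrier: "B \<subseteq> carrier S"
  using A_subset B_subset T_subset_carrier[OF one_index] by auto

lemma subgroup_A_S: "subgroup A S" and subgroup_B_S: "subgroup B S"
  using D.incl_subgroup[OF D.subgroup_T[OF one_index]] subgroup_A subgroup_B by simp_all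

text \<open>The quotient \<open>inv g \<otimes> g'\<close> lies in \<open>H\<close> and normalises
  \<open>T 1\<close>; by (iv) it normalises \<open>A\<close> and \<open>B\<close> too, so passing
  from \<open>g\<close> to \<open>g'\<close> changes neither conjugate.\<close>

lemma conj_eq_if_same_arc:
  assumes g: "g \<in> H" "g' \<in> H" and eq: "conj (T 1) g = conj (T 1) g'"
  shows "conj A g = conj A g'" "conj B g = conj B g'"
proof -
  let ?x = "inv\<^bsub>S\<^esub> g \<otimes>\<^bsub>S\<^esub> g'"
  note c = H_carrier[OF g(1)] H_carrier[OF g(2)]
  have x: "?x \<in> H" using g subgroup_H by (simp add: subgroup.m_closed subgroup.m_inv_closed)
  note xc = H_carrier[OF x]
  have "conj (T 1) ?x = T 1"
    using D.conj_set_mult[OF c(2) _ T_subset_carrier[OF one_index], of "inv\<^bsub>S\<^esub> g"] eq c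
      D.conj_set_inv(1)[OF c(1) T_subset_carrier[OF one_index]] by simp
  then have "?x \<in> H \<inter> normalizer S (T 1)"
    using x mem_normalizer_iff[OF xc T_subset_carrier[OF one_index]] by simp
  then have "?x \<in> normalizer S A" "?x \<in> normalizer S B" using normalizer_A normalizer_B by auto
  then have AB_fixed: "conj A ?x = A" "conj B ?x = B"
    using mem_normalizer_iff[OF xc] A_carrier B_carrier by auto
  have "g \<otimes>\<^bsub>S\<^esub> ?x = g'" using c by (simp add: D.m_assoc[symmetric])
  then show "conj A g = conj A g'" "conj B g = conj B g'"
    using D.conj_set_mult[OF xc c(1) A_carrier] D.conj_set_mult[OF xc c(1) B_carrier] AB_fixed by simp_all
qed

lemma vertex_factor_unique:
  assumes "transporters \<Omega> G T k \<omega> g" "transporters \<Omega> G T k \<omega> g'" "i \<in> {1..k}"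
  shows "vertex_factor \<Omega> T A B \<Gamma> g v i = vertex_factor \<Omega> T A B \<Gamma> g' v i"
  using conj_eq_if_same_arc[of "g i" "g' i"] assms by (simp add: transporters_def vertex_factor_def)

section \<open>Vertices and arcs under the point stabiliser\<close>

lemma tail_in_verts: "i \<in> {1..k} \<Longrightarrow> tail \<Gamma> (T i) \<in> verts \<Gamma>"
  and head_in_verts: "i \<in> {1..k} \<Longrightarrow> head \<Gamma> (T i) \<in> verts \<Gamma>"
  and tail_neq_head: "i \<in> {1..k} \<Longrightarrow> tail \<Gamma> (T i) \<noteq> head \<Gamma> (T i)"
proof -
  have "loopfree_digraph \<Gamma>" using digraph by (simp add: gen_digraph_def)
  then interpret loopfree_digraph \<Gamma> .
  assume "i \<in> {1..k}"
  then have "T i \<in> arcs \<Gamma>" using arcs_eq by blast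
  then show "tail \<Gamma> (T i) \<in> verts \<Gamma>" "head \<Gamma> (T i) \<in> verts \<Gamma>" "tail \<Gamma> (T i) \<noteq> head \<Gamma> (T i)"
    using no_loops by auto
qed

lemma action_tail_head:
  assumes h: "h \<in> H" and ij: "i \<in> {1..k}" "conj (T i) h = T j"
  shows "\<phi> h (tail \<Gamma> (T i)) = tail \<Gamma> (T j)" "\<phi> h (head \<Gamma> (T i)) = head \<Gamma> (T j)"
proof -
  have "T i \<in> arcs \<Gamma>" using arcs_eq ij by blast
  then show "\<phi> h (tail \<Gamma> (T i)) = tail \<Gamma> (T j)" "\<phi> h (head \<Gamma> (T i)) = head \<Gamma> (T j)"
    using auts h ij by (auto simp: digraph_auts_def)
qed

lemma action_verts:
  assumes "h \<in> H"
  shows "\<phi> h ` verts \<Gamma> = verts \<Gamma>" "inj_on (\<phi> h) (verts \<Gamma>)"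
    "v \<in> verts \<Gamma> \<Longrightarrow> \<phi> (inv\<^bsub>S\<^esub> h) (\<phi> h v) = v"
proof -
  interpret V: transitive_action "perm_group \<Omega> H" "verts \<Gamma>" \<phi> by (rule trans_verts)
  show "\<phi> h ` verts \<Gamma> = verts \<Gamma>" "inj_on (\<phi> h) (verts \<Gamma>)"
    using V.surj_prop V.inj_prop assms by simp_all
  show "\<phi> (inv\<^bsub>S\<^esub> h) (\<phi> h v) = v" if "v \<in> verts \<Gamma>"
    using V.orbit_sym_aux[of h v] assms that D.m_inv_consistent[OF subgroup_H] by simp
qed

lemma exists_action:
  assumes "v \<in> verts \<Gamma>" "w \<in> verts \<Gamma>"
  shows "\<exists>h\<in>H. \<phi> h v = w"
  using transitive_action.unique_orbit[OF trans_verts assms] by simp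

text \<open>An element of \<open>H\<close> that moves the tail of \<open>T 1\<close> to
  \<open>v\<close> acts as an automorphism, so it moves \<open>T 1\<close> to an arc with tail
  \<open>v\<close>.\<close>

lemma exists_out_arc:
  assumes "v \<in> verts \<Gamma>"
  obtains i where "i \<in> {1..k}" "tail \<Gamma> (T i) = v"
proof -
  obtain h where h: "h \<in> H" "\<phi> h (tail \<Gamma> (T 1)) = v"
    using exists_action[OF tail_in_verts[OF one_index] assms] by blast
  obtain j where j: "j \<in> {1..k}" "conj (T 1) h = T j" using arc_conj[OF h(1) one_index] .
  then show ?thesis using that action_tail_head[OF h(1) one_index j(2)] h by simp
qed

text \<open>The tails of the finitely many arcs exhaust the vertices.\<close>

lemma finite_verts: "finite (verts \<Gamma>)"
proof -
  have "verts \<Gamma> \<subseteq> (\<lambda>i. tail \<Gamma> (T i)) ` {1..k}" using exists_out_arc by blast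
  then show ?thesis by (rule finite_subset) simp
qed

section \<open>The transported subgroups A_i and B_i\<close>

context
  fixes g assumes g: "transporters \<Omega> G T k \<omega> g"
begin

abbreviation A' :: "nat \<Rightarrow> ('a \<Rightarrow> 'a) set" where "A' i \<equiv> conj A (g i)"
abbreviation B' :: "nat \<Rightarrow> ('a \<Rightarrow> 'a) set" where "B' i \<equiv> conj B (g i)"
abbreviation factor :: "'v \<Rightarrow> nat \<Rightarrow> ('a \<Rightarrow> 'a) set" where
  "factor \<equiv> vertex_factor \<Omega> T A B \<Gamma> g"
abbreviation K :: "'v \<Rightarrow> ('a \<Rightarrow> 'a) set" where "K \<equiv> vertex_subgroup \<Omega> T k A B \<Gamma> g"

lemma g_H: "i \<in> {1..k} \<Longrightarrow> g i \<in> H" and g_conj: "i \<in> {1..k} \<Longrightarrow> conj (T 1) (g i) = T i"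
  using g by (auto simp: transporters_def)

lemma g_carrier: "i \<in> {1..k} \<Longrightarrow> g i \<in> carrier S"
  using g_H H_carrier by blast

lemma A'_subset: "i \<in> {1..k} \<Longrightarrow> A' i \<subseteq> T i" and B'_subset: "i \<in> {1..k} \<Longrightarrow> B' i \<subseteq> T i"
  using g_conj[of i] A_subset B_subset by (auto simp: D.conj_set_eq_image)

lemma card_T: "i \<in> {1..k} \<Longrightarrow> card (T i) = card (T 1)"
  using D.card_conj_set[OF g_carrier T_subset_carrier[OF one_index]] g_conj by metis

lemma card_A: "card A < card (T 1)" and card_B: "card B < card (T 1)"
  using psubset_card_mono[OF finite_T[OF one_index]] A_subset A_proper B_subset B_proper by blast+

text \<open>Conjugation preserves orders, and all \<open>T i\<close> have the order of
  \<open>T 1\<close>, which is finite and exceeds the orders of \<open>A\<close> and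
  \<open>B\<close>.\<close>

lemma A'_proper: "i \<in> {1..k} \<Longrightarrow> A' i \<noteq> T i" and B'_proper: "i \<in> {1..k} \<Longrightarrow> B' i \<noteq> T i"
  using D.card_conj_set[OF g_carrier A_carrier] D.card_conj_set[OF g_carrier B_carrier]
    card_T card_A card_B by (metis nat_neq_iff)+

lemma subgroup_A': "i \<in> {1..k} \<Longrightarrow> subgroup (A' i) S"
  and subgroup_B': "i \<in> {1..k} \<Longrightarrow> subgroup (B' i) S"
  using D.subgroup_conj_set g_carrier subgroup_A_S subgroup_B_S by blast+

lemma A'_B'_prod: "i \<in> {1..k} \<Longrightarrow> A' i <#>\<^bsub>S\<^esub> B' i = T i"
  using D.conj_set_set_mult[OF g_carrier A_carrier B_carrier] A_B_prod g_conj by metis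

text \<open>Inversion reverses the factorisation. This order is the one required at the head of an
  arc, where \<open>K v\<close> contributes B_i and stands on the left.\<close>

lemma B'_A'_prod:
  assumes "i \<in> {1..k}"
  shows "B' i <#>\<^bsub>S\<^esub> A' i = T i"
proof
  note T = D.subgroup_T[OF assms] and sub = subgroup_A'[OF assms] subgroup_B'[OF assms]
  show "B' i <#>\<^bsub>S\<^esub> A' i \<subseteq> T i"
    using A'_subset[OF assms] B'_subset[OF assms] subgroup.m_closed[OF T]
    by (auto elim!: set_multE)
  show "T i \<subseteq> B' i <#>\<^bsub>S\<^esub> A' i"
  proof
    fix x assume x: "x \<in> T i"
    then have "inv\<^bsub>S\<^esub> x \<in> A' i <#>\<^bsub>S\<^esub> B' i"
      using A'_B'_prod[OF assms] subgroup.m_inv_closed[OF T] by simp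
    then obtain a b where ab: "a \<in> A' i" "b \<in> B' i" "inv\<^bsub>S\<^esub> x = a \<otimes>\<^bsub>S\<^esub> b"
      by (rule set_multE)
    have "x = inv\<^bsub>S\<^esub> (a \<otimes>\<^bsub>S\<^esub> b)"
      using ab(3) D.inv_inv[OF D.T_carrier[OF assms x]] by simp
    also have "\<dots> = inv\<^bsub>S\<^esub> b \<otimes>\<^bsub>S\<^esub> inv\<^bsub>S\<^esub> a"
      using ab(1,2) sub by (intro D.inv_mult_group) (auto dest: subgroup.mem_carrier)
    finally show "x \<in> B' i <#>\<^bsub>S\<^esub> A' i"
      using ab(1,2) sub by (metis set_multI subgroup.m_inv_closed)
  qed
qed

text \<open>M_\<omega> is the intersection of \<open>H\<close> with the normal subgroup
  \<open>M\<close>.\<close>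

lemma stab_conj:
  assumes h: "h \<in> H" and m: "m \<in> pt_stab \<Omega> M \<omega>"
  shows "h \<otimes>\<^bsub>S\<^esub> m \<otimes>\<^bsub>S\<^esub> inv\<^bsub>S\<^esub> h \<in> pt_stab \<Omega> M \<omega>"
proof -
  have mM: "m \<in> M" and mH: "m \<in> H" using m M_subset_G by (auto simp: pt_stab_eq)
  have "h \<otimes>\<^bsub>S\<^esub> m \<otimes>\<^bsub>S\<^esub> inv\<^bsub>S\<^esub> h \<in> H"
    using h mH subgroup_H by (simp add: subgroup.m_closed subgroup.m_inv_closed)
  then show ?thesis using M_conj[of h m] h mM by (simp add: pt_stab_eq)
qed

text \<open>Transport of (iii) by \<open>g i\<close>: conjugation carries the first projection to
  the \<open>i\<close>-th one and leaves M_\<omega> invariant.\<close>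

lemma A'_B'_Int:
  assumes i: "i \<in> {1..k}"
  shows "A' i \<inter> B' i = \<sigma> i ` pt_stab \<Omega> M \<omega>"
proof -
  have "A' i \<inter> B' i = conj (\<sigma> 1 ` pt_stab \<Omega> M \<omega>) (g i)"
    using D.conj_set_Int[OF g_carrier[OF i] A_carrier B_carrier] A_B_Int by simp
  also have "\<dots> = \<sigma> i ` conj (pt_stab \<Omega> M \<omega>) (g i)"
    using proj_equivariant[OF g_H[OF i] one_index i g_conj[OF i]]
    by (simp add: D.conj_set_eq_image image_image pt_stab_eq)
  also have "conj (pt_stab \<Omega> M \<omega>) (g i) = pt_stab \<Omega> M \<omega>"
  proof
    show "conj (pt_stab \<Omega> M \<omega>) (g i) \<subseteq> pt_stab \<Omega> M \<omega>"
      using stab_conj[OF g_H[OF i]] by (auto simp: D.conj_set_eq_image)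
    have "inv\<^bsub>S\<^esub> (g i) \<in> H" using subgroup.m_inv_closed[OF subgroup_H g_H[OF i]] .
    then have "conj (pt_stab \<Omega> M \<omega>) (inv\<^bsub>S\<^esub> (g i)) \<subseteq> pt_stab \<Omega> M \<omega>"
      using stab_conj by (auto simp: D.conj_set_eq_image)
    then have "conj (conj (pt_stab \<Omega> M \<omega>) (inv\<^bsub>S\<^esub> (g i))) (g i) \<subseteq> conj (pt_stab \<Omega> M \<omega>) (g i)"
      by (auto simp: D.conj_set_eq_image)
    moreover have "pt_stab \<Omega> M \<omega> \<subseteq> carrier S" using M_in_carrier by (auto simp: pt_stab_eq)
    ultimately show "pt_stab \<Omega> M \<omega> \<subseteq> conj (pt_stab \<Omega> M \<omega>) (g i)"
      using D.conj_set_inv(2)[OF g_carrier[OF i]] by simp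
  qed
  finally show ?thesis .
qed

text \<open>Both \<open>h \<otimes> g i\<close> and \<open>g j\<close> carry \<open>T 1\<close> to
  \<open>T j\<close>, so \<open>conj_eq_if_same_arc\<close> applies.\<close>

lemma conj_A'_B':
  assumes h: "h \<in> H" and ij: "i \<in> {1..k}" "j \<in> {1..k}" "conj (T i) h = T j"
  shows "conj (A' i) h = A' j" "conj (B' i) h = B' j"
proof -
  note c = g_carrier[OF ij(1)] H_carrier[OF h]
  have hg: "h \<otimes>\<^bsub>S\<^esub> g i \<in> H" using h g_H[OF ij(1)] subgroup_H by (simp add: subgroup.m_closed)
  have "conj (T 1) (h \<otimes>\<^bsub>S\<^esub> g i) = conj (T 1) (g j)"
    using D.conj_set_mult[OF c T_subset_carrier[OF one_index]] g_conj ij by simp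
  then show "conj (A' i) h = A' j" "conj (B' i) h = B' j"
    using conj_eq_if_same_arc[OF hg g_H[OF ij(2)]] D.conj_set_mult[OF c A_carrier]
      D.conj_set_mult[OF c B_carrier] by simp_all
qed

text \<open>Since \<open>g i\<close> is itself in \<open>H\<close>, it can be absorbed into the
  conjugating element in either direction.\<close>

lemma conjugate_under_H_iff:
  assumes i: "i \<in> {1..k}" and XY: "X \<subseteq> carrier S" "Y \<subseteq> carrier S"
  shows "conjugate_under S H (conj X (g i)) Y \<longleftrightarrow> conjugate_under S H X Y"
proof
  note gc = g_carrier[OF i]
  have gi: "g i \<in> H" "inv\<^bsub>S\<^esub> (g i) \<in> H"
    using g_H[OF i] subgroup.m_inv_closed[OF subgroup_H] by auto
  {
    assume "conjugate_under S H (conj X (g i)) Y"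
    then obtain h where h: "h \<in> H" "conj (conj X (g i)) h = Y" by (auto simp: conjugate_under_def)
    then have "conj X (h \<otimes>\<^bsub>S\<^esub> g i) = Y" using D.conj_set_mult[OF gc H_carrier XY(1)] by simp
    then show "conjugate_under S H X Y"
      using h gi subgroup.m_closed[OF subgroup_H] by (auto simp: conjugate_under_def)
  }
  assume "conjugate_under S H X Y"
  then obtain h where h: "h \<in> H" "conj X h = Y" by (auto simp: conjugate_under_def)
  have "conj (conj X (g i)) (h \<otimes>\<^bsub>S\<^esub> inv\<^bsub>S\<^esub> (g i)) = conj (conj (conj X (g i)) (inv\<^bsub>S\<^esub> (g i))) h"
    using D.conj_set_mult[of "inv\<^bsub>S\<^esub> (g i)" h "conj X (g i)"] gc H_carrier[OF h(1)]
      D.conj_set_subset[OF gc XY(1)] by simp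
  then have "conj (conj X (g i)) (h \<otimes>\<^bsub>S\<^esub> inv\<^bsub>S\<^esub> (g i)) = Y"
    using D.conj_set_inv(1)[OF gc XY(1)] h by simp
  moreover have "h \<otimes>\<^bsub>S\<^esub> inv\<^bsub>S\<^esub> (g i) \<in> H" using h gi subgroup.m_closed[OF subgroup_H] by blast
  ultimately show "conjugate_under S H (conj X (g i)) Y" by (auto simp: conjugate_under_def)
qed

lemma conjugate_under_H_sym:
  assumes "conjugate_under S H X Y" "X \<subseteq> carrier S"
  shows "conjugate_under S H Y X"
  using assms D.conj_set_inv(1) H_carrier subgroup.m_inv_closed[OF subgroup_H]
  unfolding conjugate_under_def by metis

lemma conjugate_under_H_refl: "X \<subseteq> carrier S \<Longrightarrow> conjugate_under S H X X"
proof -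
  assume "X \<subseteq> carrier S"
  then have "conj X \<one>\<^bsub>S\<^esub> = X" by (auto simp: D.conj_set_eq_image subset_iff image_def)
  then show ?thesis using subgroup.one_closed[OF subgroup_H] by (auto simp: conjugate_under_def)
qed

lemma conjugate_under_card: "conjugate_under S H X Y \<Longrightarrow> X \<subseteq> carrier S \<Longrightarrow> card X = card Y"
  using D.card_conj_set H_carrier by (auto simp: conjugate_under_def)

text \<open>Settles the three possible \<open>i\<close>-th coordinates of a vertex group, which
  decides where the tail of \<open>T i\<close> can lie in the new digraph.\<close>

lemma conjugacy_A:
  assumes i: "i \<in> {1..k}"
  shows "conjugate_under S H (A' i) A" "\<not> conjugate_under S H (B' i) A"
    "\<not> conjugate_under S H (T i) A"
proof -
  show "conjugate_under S H (A' i) A"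
    using conjugate_under_H_iff[OF i A_carrier A_carrier] conjugate_under_H_refl[OF A_carrier] by simp
  show "\<not> conjugate_under S H (B' i) A"
    using conjugate_under_H_iff[OF i B_carrier A_carrier] conjugate_under_H_sym[OF _ B_carrier]
      A_B_nonconj by blast
  show "\<not> conjugate_under S H (T i) A"
    using conjugate_under_card[OF _ T_subset_carrier[OF i]] card_T[OF i] card_A by auto
qed

lemma conjugacy_B:
  assumes i: "i \<in> {1..k}"
  shows "conjugate_under S H (B' i) B" "\<not> conjugate_under S H (A' i) B"
    "\<not> conjugate_under S H (T i) B"
proof -
  show "conjugate_under S H (B' i) B"
    using conjugate_under_H_iff[OF i B_carrier B_carrier] conjugate_under_H_refl[OF B_carrier] by simp
  show "\<not> conjugate_under S H (A' i) B"
    using conjugate_under_H_iff[OF i A_carrier B_carrier] A_B_nonconj by blast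
  show "\<not> conjugate_under S H (T i) B"
    using conjugate_under_card[OF _ T_subset_carrier[OF i]] card_T[OF i] card_B by auto
qed

lemma A'_neq_B': "i \<in> {1..k} \<Longrightarrow> A' i \<noteq> B' i"
  using conjugacy_A by metis

text \<open>Both orders appear because \<open>CD_2_nonconj\<close> quantifies over ordered pairs of
  members of \<open>F_set\<close>.\<close>

lemma A'_B'_nonconj:
  assumes i: "i \<in> {1..k}"
  shows "\<not> conjugate_under S H (A' i) (B' i)" "\<not> conjugate_under S H (B' i) (A' i)"
proof -
  have c: "A' i \<subseteq> carrier S" "B' i \<subseteq> carrier S"
    using A'_subset B'_subset T_subset_carrier i by blast+
  show "\<not> conjugate_under S H (A' i) (B' i)"
    using conjugate_under_H_iff[OF i A_carrier c(2)] conjugate_under_H_sym A_carrier c(2)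
      conjugate_under_H_iff[OF i B_carrier A_carrier] A_B_nonconj B_carrier by blast
  then show "\<not> conjugate_under S H (B' i) (A' i)" using conjugate_under_H_sym c by blast
qed

text \<open>A trivial A_i would turn the factorisation into B_i = T_i. The fact is used to tell
  vertex groups apart from the factors \<open>T j\<close>.\<close>

lemma A'_nontrivial:
  assumes "i \<in> {1..k}"
  shows "A' i \<noteq> {\<one>\<^bsub>S\<^esub>}"
proof
  assume "A' i = {\<one>\<^bsub>S\<^esub>}"
  moreover have "x \<in> carrier S" if "x \<in> B' i" for x
    using that B'_subset T_subset_carrier assms by blast
  ultimately have "A' i <#>\<^bsub>S\<^esub> B' i = B' i" by (force simp: set_mult_def)
  then show False using A'_B'_prod[OF assms] B'_proper[OF assms] by simp
qed

section \<open>Coordinates of the vertex groups\<close>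

lemma factor_tail: "i \<in> {1..k} \<Longrightarrow> factor (tail \<Gamma> (T i)) i = A' i"
  and factor_head: "i \<in> {1..k} \<Longrightarrow> factor (head \<Gamma> (T i)) i = B' i"
  and factor_other: "v \<noteq> tail \<Gamma> (T i) \<Longrightarrow> v \<noteq> head \<Gamma> (T i) \<Longrightarrow> factor v i = T i"
  using tail_neq_head by (auto simp: vertex_factor_def)

text \<open>A_i, B_i and T_i are pairwise distinct, so the coordinate reveals whether the vertex is
  the tail, the head or neither.\<close>

lemma factor_eq_A'_iff: "i \<in> {1..k} \<Longrightarrow> factor v i = A' i \<longleftrightarrow> v = tail \<Gamma> (T i)"
  and factor_eq_B'_iff: "i \<in> {1..k} \<Longrightarrow> factor v i = B' i \<longleftrightarrow> v = head \<Gamma> (T i)"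
  using A'_proper[of i] B'_proper[of i] A'_neq_B'[of i] tail_neq_head[of i]
  by (auto simp: vertex_factor_def)

lemma factor_cases:
  assumes "i \<in> {1..k}"
  obtains "v = tail \<Gamma> (T i)" "factor v i = A' i" | "v = head \<Gamma> (T i)" "factor v i = B' i"
    | "v \<noteq> tail \<Gamma> (T i)" "v \<noteq> head \<Gamma> (T i)" "factor v i = T i"
  using assms factor_tail factor_head factor_other by metis

lemma factor_subset: "i \<in> {1..k} \<Longrightarrow> factor v i \<subseteq> T i"
  and subgroup_factor: "i \<in> {1..k} \<Longrightarrow> subgroup (factor v i) S"
  by (cases rule: factor_cases[of i v];
      simp add: A'_subset B'_subset subgroup_A' subgroup_B' D.subgroup_T)+

lemma K_eq: "K v = {m \<in> M. \<forall>i\<in>{1..k}. \<sigma> i m \<in> factor v i}"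
  unfolding vertex_subgroup_def by (rule D.full_prod_eq) (rule factor_subset)

lemma K_subset: "K v \<subseteq> M" by (auto simp: K_eq)

lemma subgroup_K: "subgroup (K v) S"
  unfolding vertex_subgroup_def by (intro D.subgroup_full_prod subgroup_factor factor_subset)

lemma proj_K:
  assumes "i \<in> {1..k}"
  shows "\<sigma> i ` K v = factor v i"
  unfolding vertex_subgroup_def
proof (rule D.proj_image_full_prod[OF _ _ assms])
  show "factor v j \<subseteq> T j" "factor v j \<noteq> {}" if "j \<in> {1..k}" for j
    using factor_subset[OF that] subgroup.one_closed[OF subgroup_factor[OF that]] by auto
qed

lemma K_eq_iff:
  assumes "v \<in> verts \<Gamma>"
  shows "K v = K w \<longleftrightarrow> v = w"
proof
  assume eq: "K v = K w"
  obtain i where i: "i \<in> {1..k}" "tail \<Gamma> (T i) = v" using exists_out_arc assms .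
  then have "factor w i = A' i" using proj_K[OF i(1)] eq factor_tail[OF i(1)] by metis
  then show "v = w" using factor_eq_A'_iff[OF i(1)] i(2) by simp
qed simp

text \<open>At an arc with tail \<open>v\<close> the projection of \<open>K v\<close> is the proper
  subgroup A_i, whereas \<open>M\<close> projects onto T_i.\<close>

lemma K_neq_M:
  assumes "v \<in> verts \<Gamma>"
  shows "K v \<noteq> M"
proof
  assume eq: "K v = M"
  obtain i where i: "i \<in> {1..k}" "tail \<Gamma> (T i) = v" using exists_out_arc assms .
  have "T i \<subseteq> \<sigma> i ` M" using D.proj_id[OF i(1)] D.T_subset_M[OF i(1)] by force
  then have "T i \<subseteq> A' i" using proj_K[OF i(1), of v] eq factor_tail[OF i(1)] i(2) by simp
  then show False using A'_subset A'_proper i(1) by blast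
qed

text \<open>As \<open>\<phi> h\<close> is injective on vertices and compatible with tails and heads,
  \<open>v\<close> at \<open>T i\<close> and \<open>\<phi> h v\<close> at \<open>T j\<close> fall
  under the same case of \<open>vertex_factor\<close>.\<close>

lemma factor_conj:
  assumes h: "h \<in> H" and ij: "i \<in> {1..k}" "j \<in> {1..k}" "conj (T i) h = T j"
    and v: "v \<in> verts \<Gamma>"
  shows "conj (factor v i) h = factor (\<phi> h v) j"
proof -
  have "tail \<Gamma> (T j) = \<phi> h v \<longleftrightarrow> tail \<Gamma> (T i) = v" "head \<Gamma> (T j) = \<phi> h v \<longleftrightarrow> head \<Gamma> (T i) = v"
    using action_tail_head[OF h ij(1,3)] inj_onD[OF action_verts(2)[OF h]] v
      tail_in_verts[OF ij(1)] head_in_verts[OF ij(1)] by metis+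
  then show ?thesis using conj_A'_B'[OF h ij] ij(3) by (simp add: vertex_factor_def)
qed

lemma K_conj_subset:
  assumes h: "h \<in> H" and v: "v \<in> verts \<Gamma>"
  shows "conj (K v) h \<subseteq> K (\<phi> h v)"
proof
  fix x assume "x \<in> conj (K v) h"
  then obtain m where m: "m \<in> K v" "x = h \<otimes>\<^bsub>S\<^esub> m \<otimes>\<^bsub>S\<^esub> inv\<^bsub>S\<^esub> h"
    by (auto simp: D.conj_set_eq_image)
  have mM: "m \<in> M" using m(1) K_subset by blast
  have "\<sigma> j x \<in> factor (\<phi> h v) j" if j: "j \<in> {1..k}" for j
  proof -
    obtain i where i: "i \<in> {1..k}" "conj (T i) h = T j" using arc_conj_pre h j .
    have "\<sigma> j x = h \<otimes>\<^bsub>S\<^esub> \<sigma> i m \<otimes>\<^bsub>S\<^esub> inv\<^bsub>S\<^esub> h"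
      using proj_equivariant[OF h i(1) j i(2) mM] m(2) by simp
    also have "\<dots> \<in> conj (factor v i) h" using m(1) i(1) by (auto simp: K_eq D.conj_set_eq_image)
    finally show ?thesis using factor_conj[OF h i(1) j i(2) v] by simp
  qed
  moreover have "x \<in> M" using M_conj h mM m(2) H_subset_G by blast
  ultimately show "x \<in> K (\<phi> h v)" by (simp add: K_eq)
qed

lemma K_conj:
  assumes h: "h \<in> H" and v: "v \<in> verts \<Gamma>"
  shows "conj (K v) h = K (\<phi> h v)"
proof
  show "conj (K v) h \<subseteq> K (\<phi> h v)" by (rule K_conj_subset[OF h v])
  have ih: "inv\<^bsub>S\<^esub> h \<in> H" using subgroup.m_inv_closed[OF subgroup_H h] .
  have "\<phi> h v \<in> verts \<Gamma>" using action_verts(1)[OF h] v by blast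
  \<comment> \<open>The inclusion already proved, applied to the inverse element at
    \<open>\<phi> h v\<close>; conjugating it back by \<open>h\<close> gives the reverse
    inclusion.\<close>
  then have "conj (K (\<phi> h v)) (inv\<^bsub>S\<^esub> h) \<subseteq> K v"
    using K_conj_subset[OF ih, of "\<phi> h v"] action_verts(3)[OF h v] by metis
  then have "conj (conj (K (\<phi> h v)) (inv\<^bsub>S\<^esub> h)) h \<subseteq> conj (K v) h"
    by (auto simp: D.conj_set_eq_image)
  then show "K (\<phi> h v) \<subseteq> conj (K v) h"
    using D.conj_set_inv(2)[OF H_carrier[OF h] subgroup.subset[OF subgroup_K]] by simp
qed

text \<open>Exchanging the quantifiers over vertices and coordinates leaves the intersection of A_i
  and B_i in each coordinate; the product assumption on M_\<omega> then identifies the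
  result.\<close>

lemma Inter_K: "\<Inter>(K ` verts \<Gamma>) = pt_stab \<Omega> M \<omega>"
proof -
  have ne: "verts \<Gamma> \<noteq> {}" using digraph by (simp add: gen_digraph_def)
  have factors: "(\<forall>v\<in>verts \<Gamma>. x \<in> factor v i) \<longleftrightarrow> x \<in> \<sigma> i ` pt_stab \<Omega> M \<omega>" if i: "i \<in> {1..k}" for x i
  proof -
    have "(\<forall>v\<in>verts \<Gamma>. x \<in> factor v i) \<longleftrightarrow> x \<in> A' i \<inter> B' i"
    proof
      assume "\<forall>v\<in>verts \<Gamma>. x \<in> factor v i"
      then show "x \<in> A' i \<inter> B' i"
        using tail_in_verts[OF i] head_in_verts[OF i] factor_tail[OF i] factor_head[OF i] by blast
    next
      assume x: "x \<in> A' i \<inter> B' i"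
      then have "x \<in> T i" using A'_subset[OF i] by blast
      then show "\<forall>v\<in>verts \<Gamma>. x \<in> factor v i" using x by (auto simp: vertex_factor_def)
    qed
    then show ?thesis using A'_B'_Int[OF i] by simp
  qed
  have "\<Inter>(K ` verts \<Gamma>) = {m \<in> M. \<forall>i\<in>{1..k}. \<forall>v\<in>verts \<Gamma>. \<sigma> i m \<in> factor v i}"
    using ne by (auto simp: K_eq)
  also have "\<dots> = {m \<in> M. \<forall>i\<in>{1..k}. \<sigma> i m \<in> \<sigma> i ` pt_stab \<Omega> M \<omega>}"
    using factors by (intro Collect_cong conj_cong ball_cong refl)
  also have "\<dots> = full_prod S (\<lambda>i. \<sigma> i ` pt_stab \<Omega> M \<omega>) k"
    using D.proj_closed by (intro D.full_prod_eq[symmetric]) (auto simp: pt_stab_eq)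
  finally show ?thesis using stab_eq by simp
qed

lemma K_factorisation:
  assumes v: "v \<in> verts \<Gamma>"
  shows "K v <#>\<^bsub>S\<^esub> (M \<inter> \<Inter>(K ` verts \<Gamma> - {K v})) = M"
proof
  show "K v <#>\<^bsub>S\<^esub> (M \<inter> \<Inter>(K ` verts \<Gamma> - {K v})) \<subseteq> M"
    using K_subset M_closed by (auto elim!: set_multE)
  show "M \<subseteq> K v <#>\<^bsub>S\<^esub> (M \<inter> \<Inter>(K ` verts \<Gamma> - {K v}))"
  proof
    fix m assume m: "m \<in> M"
    \<comment> \<open>The second factor \<open>y\<close> has to serve all other vertices at once.
      That is possible because besides \<open>v\<close> at most one vertex imposes a proper factor
      on \<open>y\<close> if \<open>v\<close> is an end of the arc; if it is not, \<open>y\<close>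
      is taken to be the identity.\<close>
    have "\<exists>x y. x \<in> factor v i \<and> y \<in> T i \<and> (\<forall>w. w \<noteq> v \<longrightarrow> y \<in> factor w i) \<and>
        \<sigma> i m = x \<otimes>\<^bsub>S\<^esub> y" if i: "i \<in> {1..k}" for i
    proof (cases rule: factor_cases[OF i, of v])
      case 1
      obtain x y where xy: "x \<in> A' i" "y \<in> B' i" "\<sigma> i m = x \<otimes>\<^bsub>S\<^esub> y"
        using A'_B'_prod[OF i] D.proj_closed[OF i m] by (metis set_multE)
      have "y \<in> T i" using xy B'_subset[OF i] by blast
      moreover have "y \<in> factor w i" if "w \<noteq> v" for w
        using that xy(2) 1(1) \<open>y \<in> T i\<close> by (simp add: vertex_factor_def)
      ultimately show ?thesis using xy 1 by auto
    next
      case 2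
      obtain x y where xy: "x \<in> B' i" "y \<in> A' i" "\<sigma> i m = x \<otimes>\<^bsub>S\<^esub> y"
        using B'_A'_prod[OF i] D.proj_closed[OF i m] by (metis set_multE)
      have "y \<in> T i" using xy A'_subset[OF i] by blast
      moreover have "y \<in> factor w i" if "w \<noteq> v" for w
        using that xy(2) 2(1) \<open>y \<in> T i\<close> by (simp add: vertex_factor_def)
      ultimately show ?thesis using xy 2 by auto
    next
      case 3
      have "\<sigma> i m = \<sigma> i m \<otimes>\<^bsub>S\<^esub> \<one>\<^bsub>S\<^esub>" using D.proj_closed[OF i m] D.T_carrier[OF i] by simp
      then show ?thesis
        using 3 D.proj_closed[OF i m] D.one_in_T[OF i] subgroup.one_closed[OF subgroup_factor[OF i]]
        by blast
    qed
    then obtain x y where xy: "\<And>i. i \<in> {1..k} \<Longrightarrow> x i \<in> factor v i" "\<And>i. i \<in> {1..k} \<Longrightarrow> y i \<in> T i"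
        "\<And>i w. i \<in> {1..k} \<Longrightarrow> w \<noteq> v \<Longrightarrow> y i \<in> factor w i"
        "\<And>i. i \<in> {1..k} \<Longrightarrow> \<sigma> i m = x i \<otimes>\<^bsub>S\<^esub> y i"
      by metis
    obtain a where a: "a \<in> M" "\<And>i. i \<in> {1..k} \<Longrightarrow> \<sigma> i a = x i"
      using D.exists_with_projs[of x] xy(1) factor_subset by blast
    obtain b where b: "b \<in> M" "\<And>i. i \<in> {1..k} \<Longrightarrow> \<sigma> i b = y i"
      using D.exists_with_projs[of y] xy(2) by blast
    have "m = a \<otimes>\<^bsub>S\<^esub> b"
      using D.proj_hom a b xy(4) by (intro D.eq_if_projs_eq[OF m M_closed[OF a(1) b(1)]]) simp
    moreover have "a \<in> K v" using a xy(1) by (simp add: K_eq)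
    \<comment> \<open>The system is a set of subgroups, so its other members are the
      \<open>K w\<close> different from \<open>K v\<close>; for these \<open>w\<close> differs from
      \<open>v\<close>.\<close>
    moreover have "b \<in> K w" if "K w \<noteq> K v" for w
    proof -
      have "w \<noteq> v" using that by blast
      then show ?thesis unfolding K_eq[of w] using b xy(3) by simp
    qed
    then have "b \<in> M \<inter> \<Inter>(K ` verts \<Gamma> - {K v})" using b(1) by blast
    ultimately show "m \<in> K v <#>\<^bsub>S\<^esub> (M \<inter> \<Inter>(K ` verts \<Gamma> - {K v}))"
      using set_multI by metis
  qed
qed

lemma cartesian_system_K: "cartesian_system \<Omega> M \<omega> (K ` verts \<Gamma>)"
  unfolding cartesian_system_def
proof (intro conjI ballI)
  show "finite (K ` verts \<Gamma>)" using finite_verts by simp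
  show "K ` verts \<Gamma> \<noteq> {}" using digraph by (simp add: gen_digraph_def)
  show "\<Inter>(K ` verts \<Gamma>) = pt_stab \<Omega> M \<omega>" by (rule Inter_K)
  fix L assume "L \<in> K ` verts \<Gamma>"
  then obtain v where v: "v \<in> verts \<Gamma>" "L = K v" by blast
  show "subgroup L (perm_group \<Omega> M)"
    using D.subgroup_incl[OF subgroup_K subgroup_M_S K_subset] v by simp
  show "L \<noteq> M" using K_neq_M v by simp
  show "L <#>\<^bsub>S\<^esub> (M \<inter> \<Inter>(K ` verts \<Gamma> - {L})) = M" using K_factorisation v by simp
qed

lemma K_conj_closed:
  assumes h: "h \<in> H" and "L \<in> K ` verts \<Gamma>"
  shows "conj L h \<in> K ` verts \<Gamma>"
proof -
  obtain v where v: "v \<in> verts \<Gamma>" "L = K v" using assms(2) by blast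
  have "\<phi> h v \<in> verts \<Gamma>" using action_verts(1)[OF h] v(1) by blast
  then show ?thesis using K_conj[OF h v(1)] v(2) by simp
qed

lemma K_conj_transitive:
  assumes "L \<in> K ` verts \<Gamma>" "L' \<in> K ` verts \<Gamma>"
  shows "\<exists>h\<in>H. conj L h = L'"
proof -
  obtain v w where v: "v \<in> verts \<Gamma>" "L = K v" and w: "w \<in> verts \<Gamma>" "L' = K w"
    using assms by blast
  obtain h where h: "h \<in> H" "\<phi> h v = w" using exists_action[OF v(1) w(1)] by blast
  then show ?thesis using K_conj[OF h(1) v(1)] v(2) w(2) by auto
qed

section \<open>The resulting decomposition and its digraph\<close>

abbreviation \<E> :: "'a set set set" where "\<E> \<equiv> decomposition_of \<Omega> M \<omega> (K ` verts \<Gamma>)"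

lemma system_of_E: "system_of \<Omega> M \<omega> \<E> = K ` verts \<Gamma>"
  by (rule system_of_decomposition_of[OF cartesian_system_K])

lemma F_set_E:
  assumes i: "i \<in> {1..k}"
  shows "F_set \<Omega> M T k \<omega> \<E> i = {A' i, B' i}"
proof -
  have "F_set \<Omega> M T k \<omega> \<E> i = {factor v i | v. v \<in> verts \<Gamma> \<and> factor v i \<noteq> T i}"
    by (simp only: F_set_def system_of_E proj_K[OF i, symmetric]) blast
  also have "\<dots> = {A' i, B' i}"
  proof
    show "{factor v i | v. v \<in> verts \<Gamma> \<and> factor v i \<noteq> T i} \<subseteq> {A' i, B' i}"
      by (auto simp: vertex_factor_def)
    have "A' i \<in> {factor v i | v. v \<in> verts \<Gamma> \<and> factor v i \<noteq> T i}"
      unfolding mem_Collect_eq using factor_tail[OF i] tail_in_verts[OF i] A'_proper[OF i]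
      by (intro exI[of _ "tail \<Gamma> (T i)"]) simp
    moreover have "B' i \<in> {factor v i | v. v \<in> verts \<Gamma> \<and> factor v i \<noteq> T i}"
      unfolding mem_Collect_eq using factor_head[OF i] head_in_verts[OF i] B'_proper[OF i]
      by (intro exI[of _ "head \<Gamma> (T i)"]) simp
    ultimately show "{A' i, B' i} \<subseteq> {factor v i | v. v \<in> verts \<Gamma> \<and> factor v i \<noteq> T i}" by simp
  qed
  finally show ?thesis .
qed

lemma E_in_CD_2_nonconj: "\<E> \<in> CD_2_nonconj \<Omega> G M T k \<omega>"
proof -
  have "\<E> \<in> CD_tr \<Omega> G"
    using decomposition_of_in_CD_tr[OF cartesian_system_K] K_conj_closed K_conj_transitive by blast
  moreover have "card (F_set \<Omega> M T k \<omega> \<E> i) = 2 \<and>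
     (\<forall>X \<in> F_set \<Omega> M T k \<omega> \<E> i. \<forall>Y \<in> F_set \<Omega> M T k \<omega> \<E> i. X \<noteq> Y \<longrightarrow>
        \<not> conjugate_under S H X Y)" if i: "i \<in> {1..k}" for i
    unfolding F_set_E[OF i] using A'_neq_B'[OF i] A'_B'_nonconj[OF i] by auto
  ultimately show ?thesis by (simp add: CD_2_nonconj_def)
qed

text \<open>Among the three possible coordinates only A_i is conjugate to \<open>A\<close> under
  \<open>H\<close>, and it occurs only at the tail.\<close>

lemma end_at_A_iff:
  assumes i: "i \<in> {1..k}"
  shows "end_at \<Omega> G M T k \<omega> A \<E> i L \<longleftrightarrow> L = K (tail \<Gamma> (T i))"
proof -
  have "conjugate_under S H (factor v i) A \<longleftrightarrow> v = tail \<Gamma> (T i)" for v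
    using conjugacy_A[OF i] factor_eq_A'_iff[OF i, of v] factor_cases[OF i, of v] by metis
  then show ?thesis
    unfolding end_at_def system_of_E using proj_K[OF i] tail_in_verts[OF i] by auto
qed

lemma end_at_B_iff:
  assumes i: "i \<in> {1..k}"
  shows "end_at \<Omega> G M T k \<omega> B \<E> i L \<longleftrightarrow> L = K (head \<Gamma> (T i))"
proof -
  have "conjugate_under S H (factor v i) B \<longleftrightarrow> v = head \<Gamma> (T i)" for v
    using conjugacy_B[OF i] factor_eq_B'_iff[OF i, of v] factor_cases[OF i, of v] by metis
  then show ?thesis
    unfolding end_at_def system_of_E using proj_K[OF i] head_in_verts[OF i] by auto
qed

abbreviation \<Delta> :: "(('a \<Rightarrow> 'a) set, ('a \<Rightarrow> 'a) set) pre_digraph" where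
  "\<Delta> \<equiv> digraph_of \<Omega> G M T k \<omega> A B \<E>"

lemma verts_\<Delta>: "verts \<Delta> = K ` verts \<Gamma>" and arcs_\<Delta>: "arcs \<Delta> = T ` {1..k}"
  by (simp_all add: digraph_of_def system_of_E)

lemma tail_\<Delta>:
  assumes i: "i \<in> {1..k}"
  shows "tail \<Delta> (T i) = K (tail \<Gamma> (T i))"
proof -
  \<comment> \<open>Injectivity of \<open>T\<close> forces the index to be \<open>i\<close>, so the
    definite description in \<open>digraph_of\<close> has exactly one solution.\<close>
  have "(\<exists>j\<in>{1..k}. T i = T j \<and> end_at \<Omega> G M T k \<omega> A \<E> j L) \<longleftrightarrow> L = K (tail \<Gamma> (T i))" for L
    using i end_at_A_iff inj_onD[OF inj_on_T] by metis
  then show ?thesis by (simp add: digraph_of_def del: atLeastAtMost_iff)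
qed

lemma head_\<Delta>:
  assumes i: "i \<in> {1..k}"
  shows "head \<Delta> (T i) = K (head \<Gamma> (T i))"
proof -
  have "(\<exists>j\<in>{1..k}. T i = T j \<and> end_at \<Omega> G M T k \<omega> B \<E> j L) \<longleftrightarrow> L = K (head \<Gamma> (T i))" for L
    using i end_at_B_iff inj_onD[OF inj_on_T] by metis
  then show ?thesis by (simp add: digraph_of_def del: atLeastAtMost_iff)
qed

text \<open>Distinct ends of an arc stay distinct because \<open>K\<close> is injective on
  vertices.\<close>

lemma gen_digraph_\<Delta>: "gen_digraph \<Delta>"
proof -
  have "loopfree_digraph \<Delta>"
  proof
    fix e assume "e \<in> arcs \<Delta>"
    then obtain i where i: "i \<in> {1..k}" "e = T i" using arcs_\<Delta> by auto
    show "tail \<Delta> e \<in> verts \<Delta>" "head \<Delta> e \<in> verts \<Delta>"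
      using tail_\<Delta>[OF i(1)] head_\<Delta>[OF i(1)] tail_in_verts[OF i(1)] head_in_verts[OF i(1)] i(2)
      unfolding verts_\<Delta> by simp_all
    show "tail \<Delta> e \<noteq> head \<Delta> e"
      using tail_\<Delta>[OF i(1)] head_\<Delta>[OF i(1)] tail_neq_head[OF i(1)] i(2)
        K_eq_iff[OF tail_in_verts[OF i(1)]] by simp
  qed
  moreover have "verts \<Delta> \<noteq> {}" unfolding verts_\<Delta> using digraph by (simp add: gen_digraph_def)
  ultimately show ?thesis by (simp add: gen_digraph_def)
qed

text \<open>The coordinates of \<open>T\<^sub>j\<close> are \<open>T\<^sub>j\<close> and trivial groups, whereas \<open>K\<^sub>v\<close> has the coordinate \<open>A\<^sub>i\<close>
  if \<open>v\<close> is the tail of \<open>T\<^sub>i\<close>.\<close>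

lemma verts_arcs_\<Delta>_disjoint: "verts \<Delta> \<inter> arcs \<Delta> = {}"
proof (rule ccontr)
  assume "verts \<Delta> \<inter> arcs \<Delta> \<noteq> {}"
  then obtain v j where v: "v \<in> verts \<Gamma>" and j: "j \<in> {1..k}" and eq: "K v = T j"
    unfolding verts_\<Delta> arcs_\<Delta> by blast
  obtain i where i: "i \<in> {1..k}" "tail \<Gamma> (T i) = v" using exists_out_arc v .
  have fac: "\<sigma> i ` T j = A' i" using proj_K[OF i(1), of v] factor_tail[OF i(1)] i(2) eq by simp
  show False
  proof (cases "i = j")
    case True
    then have "\<sigma> i ` T j = T i" using D.proj_id[OF i(1)] by force
    then show False using fac A'_proper[OF i(1)] by simp
  next
    case False
    have "\<sigma> i t = \<one>\<^bsub>S\<^esub>" if "t \<in> T j" for t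
      using D.proj_other[of i "[j]" t] D.T_subset_P[of "[j]" j] i(1) j False that by auto
    then have "\<sigma> i ` T j \<subseteq> {\<one>\<^bsub>S\<^esub>}" by auto
    then have "A' i \<subseteq> {\<one>\<^bsub>S\<^esub>}" using fac by simp
    then show False using A'_nontrivial[OF i(1)] subgroup.one_closed[OF subgroup_A'[OF i(1)]] by blast
  qed
qed

lemma identifies_\<Delta>: "identifies K \<Gamma> \<Delta>"
  unfolding identifies_def
proof (intro conjI ballI)
  show "bij_betw K (verts \<Gamma>) (verts \<Delta>)"
    unfolding bij_betw_def verts_\<Delta> using K_eq_iff by (auto intro: inj_onI)
  show "arcs \<Delta> = arcs \<Gamma>" using arcs_\<Delta> arcs_eq by simp
  fix e assume "e \<in> arcs \<Gamma>"
  then obtain i where i: "i \<in> {1..k}" "e = T i" using arcs_eq by auto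
  show "tail \<Delta> e = K (tail \<Gamma> e)" "head \<Delta> e = K (head \<Gamma> e)"
    using tail_\<Delta>[OF i(1)] head_\<Delta>[OF i(1)] i(2) by simp_all
qed

end

end

theorem mainTheorem5:
  fixes \<Omega> :: "'a set" and \<omega> :: 'a and G M A1 B1 :: "('a \<Rightarrow> 'a) set"
    and T :: "nat \<Rightarrow> ('a \<Rightarrow> 'a) set" and k :: nat
    and \<Gamma> :: "('v, ('a \<Rightarrow> 'a) set) pre_digraph"
    and \<phi> :: "('a \<Rightarrow> 'a) \<Rightarrow> 'v \<Rightarrow> 'v"
  defines "Sym \<equiv> BijGroup \<Omega>"
    and "G\<omega> \<equiv> pt_stab \<Omega> G \<omega>"
    and "M\<omega> \<equiv> pt_stab \<Omega> M \<omega>"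
    and "\<sigma> \<equiv> proj (BijGroup \<Omega>) T k"
  assumes "innately_transitive \<Omega> G" and "finite G"
    and "plinth \<Omega> G M" and "\<not> comm_group (perm_group \<Omega> M)"
    and "simple_direct_factors Sym M T k"
    and "\<omega> \<in> \<Omega>"
    and "M\<omega> = full_prod Sym (\<lambda>i. \<sigma> i ` M\<omega>) k"
    and "subgroup A1 (perm_group \<Omega> (T 1))" and "subgroup B1 (perm_group \<Omega> (T 1))"
    and "A1 \<noteq> T 1" and "B1 \<noteq> T 1"
    and "\<not> conjugate_under Sym G\<omega> A1 B1"
    and "A1 <#>\<^bsub>Sym\<^esub> B1 = T 1" and "A1 \<inter> B1 = \<sigma> 1 ` M\<omega>"
    and "G\<omega> \<inter> normalizer Sym (T 1) = G\<omega> \<inter> normalizer Sym A1"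
    and "G\<omega> \<inter> normalizer Sym A1 = G\<omega> \<inter> normalizer Sym B1"
    and "gen_digraph \<Gamma>" and "arcs \<Gamma> = T ` {1..k}"
    and "transitive_action (perm_group \<Omega> G\<omega>) (verts \<Gamma>) \<phi>"
    and "transitive_action (perm_group \<Omega> G\<omega>) (arcs \<Gamma>) (\<lambda>h. \<lambda>S\<in>arcs \<Gamma>. conj_set Sym S h)"
    and "\<forall>h\<in>G\<omega>. (\<phi> h, \<lambda>S\<in>arcs \<Gamma>. conj_set Sym S h) \<in> digraph_auts \<Gamma>"
  shows
    "(\<exists>g. transporters \<Omega> G T k \<omega> g) \<and>
     (\<forall>g g'. transporters \<Omega> G T k \<omega> g \<longrightarrow> transporters \<Omega> G T k \<omega> g' \<longrightarrow>
        (\<forall>v\<in>verts \<Gamma>. \<forall>i\<in>{1..k}.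
           vertex_factor \<Omega> T A1 B1 \<Gamma> g v i = vertex_factor \<Omega> T A1 B1 \<Gamma> g' v i)) \<and>
     (\<forall>g. transporters \<Omega> G T k \<omega> g \<longrightarrow>
        (let K = vertex_subgroup \<Omega> T k A1 B1 \<Gamma> g;
             \<K> = K ` verts \<Gamma>;
             \<E> = decomposition_of \<Omega> M \<omega> \<K>;
             \<Delta> = digraph_of \<Omega> G M T k \<omega> A1 B1 \<E>
         in cartesian_system \<Omega> M \<omega> \<K> \<and>
            (\<forall>h\<in>G\<omega>. \<forall>L\<in>\<K>. conj_set Sym L h \<in> \<K>) \<and>
            (\<forall>L\<in>\<K>. \<forall>L'\<in>\<K>. \<exists>h\<in>G\<omega>. conj_set Sym L h = L') \<and>
            \<E> \<in> CD_2_nonconj \<Omega> G M T k \<omega> \<and>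
            (\<forall>i\<in>{1..k}. (\<exists>!L. end_at \<Omega> G M T k \<omega> A1 \<E> i L) \<and>
                         (\<exists>!L. end_at \<Omega> G M T k \<omega> B1 \<E> i L)) \<and>
            gen_digraph \<Delta> \<and> verts \<Delta> \<inter> arcs \<Delta> = {} \<and>
            identifies K \<Gamma> \<Delta> \<and>
            (\<forall>i\<in>{1..k}. F_set \<Omega> M T k \<omega> \<E> i =
               {conj_set Sym A1 (g i), conj_set Sym B1 (g i)})))"
proof -
  note defs = Sym_def G\<omega>_def M\<omega>_def \<sigma>_def
  interpret digraph_construction \<Omega> G M \<omega> T k A1 B1 \<Gamma> \<phi>
  proof (intro digraph_construction.intro transitive_normal_subgroup.intro
      digraph_construction_axioms.intro)
    show "subgroup G (BijGroup \<Omega>)"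
      using \<open>innately_transitive \<Omega> G\<close> by (simp add: innately_transitive_def)
    show "M \<lhd> perm_group \<Omega> G" "M \<noteq> {\<one>\<^bsub>BijGroup \<Omega>\<^esub>}"
      "transitive_action (perm_group \<Omega> M) \<Omega> (\<lambda>m. m)"
      using \<open>plinth \<Omega> G M\<close> by (simp_all add: plinth_def minimal_normal_def)
  qed (fact assms[unfolded defs])+
  show ?thesis
    unfolding Let_def defs
  proof (intro conjI allI impI ballI)
    show "\<exists>g. transporters \<Omega> G T k \<omega> g" by (rule exists_transporters)
  next
    fix g g' v i assume "transporters \<Omega> G T k \<omega> g" "transporters \<Omega> G T k \<omega> g'" "i \<in> {1..k}"
    then show "vertex_factor \<Omega> T A1 B1 \<Gamma> g v i = vertex_factor \<Omega> T A1 B1 \<Gamma> g' v i"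
      by (rule vertex_factor_unique)
  next
    fix g i assume g: "transporters \<Omega> G T k \<omega> g" and i: "i \<in> {1..k}"
    show "\<exists>!L. end_at \<Omega> G M T k \<omega> A1 (\<E> g) i L" using end_at_A_iff[OF g i] by simp
    show "\<exists>!L. end_at \<Omega> G M T k \<omega> B1 (\<E> g) i L" using end_at_B_iff[OF g i] by simp
  qed (fact cartesian_system_K K_conj_closed K_conj_transitive E_in_CD_2_nonconj gen_digraph_\<Delta>
      verts_arcs_\<Delta>_disjoint identifies_\<Delta> F_set_E)+
qed

end
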